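(* Let $y\in\mathcal{F}_{\mathbb{Z}}$ and $(p,q)\in\mathrm{Cyc}_{\mathbb{Z}}(y)$. The FPF-involution Little map $\hat{\mathcal{B}}^{\mathtt{FPF}}_y$ restricts to a bijection $$\bigcup_{z\in\hat\Psi^+(y,q)}\hat{\mathcal{R}}_{\mathtt{FPF}}(z)\to\bigcup_{z\in\hat\Psi^-(y,p)}\hat{\mathcal{R}}_{\mathtt{FPF}}(z).$$
   Context: $S_{\mathbb{Z}}$ is the group of permutations of $\mathbb{Z}$ fixing all but finitely many integers; $(i,j)$ denotes a transposition; $s_i=(i,i+1)$; $\ell(w)$ is the number of pairs $i<j$ with $w(i)>w(j)$. A reduced word for $w$ is a sequence $(s_{i_1},\dots,s_{i_k})$ with $w=s_{i_1}\cdots s_{i_k}$ and $k=\ell(w)$. Let $\Theta:\mathbb{Z}\to\mathbb{Z}$, $\Theta(i)=i-(-1)^i$, and let $\mathcal{F}_{\mathbb{Z}}=\{w^{-1}\Theta w:w\in S_{\mathbb{Z}}\}$. For $z\in\mathcal{F}_{\mathbb{Z}}$: $\mathrm{Inv}(z)=\{(i,j)\in\mathbb{Z}\times\mathbb{Z}:i<j,\ z(i)>z(j)\}$, $\mathrm{Cyc}_{\mathbb{Z}}(z)=\{(i,j)\in\mathbb{Z}\times\mathbb{Z}:i\le j=z(i)\}$, $\hat\ell_{\mathtt{FPF}}(z)=\frac12|\mathrm{Inv}(z)-\mathrm{Cyc}_{\mathbb{Z}}(z)|$ (a finite nonnegative integer). The Bruhat order $<$ on $\mathcal{F}_{\mathbb{Z}}$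 is the weakest partial order with $z<tzt$ whenever $t\in S_{\mathbb{Z}}$ is a transposition with $\hat\ell_{\mathtt{FPF}}(z)<\hat\ell_{\mathtt{FPF}}(tzt)$; $y\lessdot_{\mathcal{F}}z$ means $\{y\}=\{w\in\mathcal{F}_{\mathbb{Z}}:y\le w<z\}$. For $y\in\mathcal{F}_{\mathbb{Z}}$, $r\in\mathbb{Z}$: $\hat\Psi^+(y,r)=\{z\in\mathcal{F}_{\mathbb{Z}}:y\lessdot_{\mathcal{F}}z$ and $z=(r,j)y(r,j)$ for an integer $j>r\}$, $\hat\Psi^-(y,r)=\{z\in\mathcal{F}_{\mathbb{Z}}:y\lessdot_{\mathcal{F}}z$ and $z=(i,r)y(i,r)$ for an integer $i<r\}$. $\mathcal{A}_{\mathtt{FPF}}(z)$ is the set of $w\in S_{\mathbb{Z}}$ of minimal length with $z=w^{-1}\Theta w$, and $\hat{\mathcal{R}}_{\mathtt{FPF}}(z)$ is the set of all reduced words of all elements of $\mathcal{A}_{\mathtt{FPF}}(z)$. The FPF-involution Little map: for a sequence $\mathbf{a}=(s_{a_1},\dots,s_{a_k})$ of simple transpositions and $i\in\{1,\dots,k\}$, let $\mathrm{del}_i(\mathbf{a})$ be $\mathbf{a}$ with its $i$th entry deleted. $(\mathbf{a},i)$ is a $y$-marked FPF-involution word if $\mathrm{del}_i(\mathbf{a})\in\hat{\mathcal{R}}_{\mathtt{FPF}}(y)$. It is reduced if $\mathbf{a}\in\hat{\mathcal{R}}_{\mathtt{FPF}}(z)$ for some $z\in\mathcal{F}_{\mathbb{Z}}$.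 It is semi-reduced if $u^{-1}\Theta u=v^{-1}\Theta v$ for $u=s_{a_1}\cdots s_{a_k}$ and $v=s_{a_1}\cdots\widehat{s_{a_i}}\cdots s_{a_k}$ (the product with the $i$th factor omitted). It is known that if a $y$-marked FPF-involution word $(\mathbf{a},i)$ is neither reduced nor semi-reduced, then there is a unique $j\ne i$ such that $(\mathbf{a},j)$ is a $y$-marked FPF-involution word. For a $y$-marked FPF-involution word $(\mathbf{a},i)$, define $(\mathbf{a},i){\Downarrow}=(\mathbf{b},j)$, where $\mathbf{b}=(s_{a_1},\dots,s_{a_{i-1}},s_{a_i-1},s_{a_{i+1}},\dots,s_{a_k})$, and $j=i$ if $(\mathbf{b},i)$ is reduced or semi-reduced, while otherwise $j$ is the unique index distinct from $i$ such that $(\mathbf{b},j)$ is a $y$-marked FPF-involution word. Define $\hat{\mathcal{B}}^{\mathtt{FPF}}(\mathbf{a},i)$ as the result of applying $\Downarrow$ to $(\mathbf{a},i)$ exactly $N$ times, where $N>0$ is minimal such that the result is reduced (such $N$ exists). If $y\lessdot_{\mathcal{F}}z$ and $\mathbf{a}\in\hat{\mathcal{R}}_{\mathtt{FPF}}(z)$, then there is a unique index $i$ such that $(\mathbf{a},i)$ is a reduced $y$-marked FPF-involution word; define $\hat{\mathcal{B}}^{\mathtt{FPF}}_y(\mathbf{a})=\mathbf{b}$ where $\hat{\mathcal{B}}^{\mathtt{FPF}}(\mathbf{a},i)=(\mathbf{b},j)$. This makes $\hat{\mathcal{B}}^{\mathtt{FPF}}_y$ a map from $\bigcup_z\hat{\mathcal{R}}_{\mathtt{FPF}}(z)$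 to itself, the union over $z\in\mathcal{F}_{\mathbb{Z}}$ with $y\lessdot_{\mathcal{F}}z$. *)

theory Defs
  imports Complex_Main "HOL-Combinatorics.Transposition"
begin

definition SZ :: "(int \<Rightarrow> int) set" where
  "SZ = {w. bij w \<and> finite {i. w i \<noteq> i}}"

definition Inv :: "(int \<Rightarrow> int) \<Rightarrow> (int \<times> int) set" where
  "Inv w = {(i, j). i < j \<and> w i > w j}"

definition ell :: "(int \<Rightarrow> int) \<Rightarrow> nat" where
  "ell w = card (Inv w)"

definition simple :: "int \<Rightarrow> int \<Rightarrow> int" where
  "simple i = transpose i (i + 1)"

text \<open>A sequence of simple transpositions is encoded by the list of its indices:
  the list \<open>[a\<^sub>1, \<dots>, a\<^sub>k]\<close> stands for the word whose letters are \<open>simple a\<^sub>1, \<dots>, simple a\<^sub>k\<close>,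
  and its product \<open>simple a\<^sub>1 \<circ> \<dots> \<circ> simple a\<^sub>k\<close> applies the rightmost factor first.\<close>

definition word_prod :: "int list \<Rightarrow> int \<Rightarrow> int" where
  "word_prod a = foldr (\<lambda>i f. simple i \<circ> f) a id"

definition reduced_words :: "(int \<Rightarrow> int) \<Rightarrow> int list set" where
  "reduced_words w = {a. word_prod a = w \<and> length a = ell w}"

text \<open>The sign \<open>(-1)\<^sup>i\<close> for an integer \<open>i\<close> only depends on \<open>\<bar>i\<bar>\<close>.\<close>

definition Theta :: "int \<Rightarrow> int" where
  "Theta i = i - (-1) ^ nat \<bar>i\<bar>"

lemma Theta_parity: "Theta i = (if even i then i - 1 else i + 1)"
  by (auto simp: Theta_def even_nat_iff)

definition twist :: "(int \<Rightarrow> int) \<Rightarrow> int \<Rightarrow> int" where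
  "twist w = inv w \<circ> Theta \<circ> w"

definition FZ :: "(int \<Rightarrow> int) set" where
  "FZ = twist ` SZ"

definition Cyc :: "(int \<Rightarrow> int) \<Rightarrow> (int \<times> int) set" where
  "Cyc z = {(i, j). i \<le> j \<and> j = z i}"

definition ell_FPF :: "(int \<Rightarrow> int) \<Rightarrow> rat" where
  "ell_FPF z = of_nat (card (Inv z - Cyc z)) / 2"

definition bruhat_step :: "(int \<Rightarrow> int) \<Rightarrow> (int \<Rightarrow> int) \<Rightarrow> bool" where
  "bruhat_step y z \<longleftrightarrow> y \<in> FZ \<and>
     (\<exists>i j. i \<noteq> j \<and> z = transpose i j \<circ> y \<circ> transpose i j \<and> ell_FPF y < ell_FPF z)"

text \<open>The weakest partial order containing \<open>bruhat_step\<close> is its reflexive-transitive closure;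
  see \<open>bruhat_partial_order\<close> and \<open>bruhat_weakest\<close> below.\<close>

definition bruhat_le :: "(int \<Rightarrow> int) \<Rightarrow> (int \<Rightarrow> int) \<Rightarrow> bool" where
  "bruhat_le = bruhat_step\<^sup>*\<^sup>*"

definition bruhat_less :: "(int \<Rightarrow> int) \<Rightarrow> (int \<Rightarrow> int) \<Rightarrow> bool" where
  "bruhat_less y z \<longleftrightarrow> bruhat_le y z \<and> y \<noteq> z"

definition covers :: "(int \<Rightarrow> int) \<Rightarrow> (int \<Rightarrow> int) \<Rightarrow> bool" where
  "covers y z \<longleftrightarrow> {y} = {w \<in> FZ. bruhat_le y w \<and> bruhat_less w z}"

lemma transpose_comp_SZ:
  assumes "w \<in> SZ" shows "w \<circ> transpose i j \<in> SZ"
proof -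
  have "{k. (w \<circ> transpose i j) k \<noteq> k} \<subseteq> {k. w k \<noteq> k} \<union> {i, j}"
    by (auto simp: transpose_def)
  moreover have "bij (w \<circ> transpose i j)"
    using assms by (simp add: SZ_def bij_comp)
  ultimately show ?thesis
    using assms by (auto simp: SZ_def intro: finite_subset)
qed

lemma transpose_conj_FZ:
  assumes "y \<in> FZ" shows "transpose i j \<circ> y \<circ> transpose i j \<in> FZ"
proof -
  obtain w where w: "w \<in> SZ" "y = twist w"
    using assms by (auto simp: FZ_def)
  have "inv (w \<circ> transpose i j) = transpose i j \<circ> inv w"
    using w by (simp add: SZ_def o_inv_distrib)
  then have "transpose i j \<circ> y \<circ> transpose i j = twist (w \<circ> transpose i j)"
    by (simp add: w twist_def comp_assoc)
  then show ?thesis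
    using transpose_comp_SZ[OF w(1)] by (auto simp: FZ_def)
qed

lemma bruhat_le_FZ: "bruhat_le y z \<Longrightarrow> y \<in> FZ \<Longrightarrow> z \<in> FZ"
  unfolding bruhat_le_def
  by (induction rule: rtranclp_induct) (auto simp: bruhat_step_def transpose_conj_FZ)

lemma bruhat_le_ell: "bruhat_le y z \<Longrightarrow> y = z \<or> ell_FPF y < ell_FPF z"
  unfolding bruhat_le_def
  by (induction rule: rtranclp_induct) (auto simp: bruhat_step_def)

lemma bruhat_partial_order:
  "partial_order_on FZ {(y, z). y \<in> FZ \<and> bruhat_le y z}"
proof -
  have "y = z" if "bruhat_le y z" "bruhat_le z y" for y z
    using bruhat_le_ell[OF that(1)] bruhat_le_ell[OF that(2)] by (metis less_asym)
  then have "antisym {(y, z). y \<in> FZ \<and> bruhat_le y z}"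
    by (auto intro: antisymI)
  moreover have "trans {(y, z). y \<in> FZ \<and> bruhat_le y z}"
    by (rule transI) (auto simp: bruhat_le_def)
  moreover have "refl_on FZ {(y, z). y \<in> FZ \<and> bruhat_le y z}"
    by (auto simp: refl_on_def bruhat_le_def)
  ultimately show ?thesis
    by (auto simp: partial_order_on_def preorder_on_def dest: bruhat_le_FZ)
qed

lemma bruhat_weakest:
  assumes "partial_order_on FZ R" "\<And>y z. bruhat_step y z \<Longrightarrow> (y, z) \<in> R"
  shows "{(y, z). y \<in> FZ \<and> bruhat_le y z} \<subseteq> R"
proof -
  have "(y, z) \<in> R" if "bruhat_le y z" "y \<in> FZ" for y z
    using that unfolding bruhat_le_def
  proof (induction rule: rtranclp_induct)
    case base
    then show ?case
      using assms(1) by (auto simp: partial_order_on_def preorder_on_def refl_on_def)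
  next
    case (step u v)
    then show ?case
      using assms by (auto simp: partial_order_on_def preorder_on_def dest: transD)
  qed
  then show ?thesis by auto
qed

definition Psi_plus :: "(int \<Rightarrow> int) \<Rightarrow> int \<Rightarrow> (int \<Rightarrow> int) set" where
  "Psi_plus y r = {z \<in> FZ. covers y z \<and> (\<exists>j>r. z = transpose r j \<circ> y \<circ> transpose r j)}"

definition Psi_minus :: "(int \<Rightarrow> int) \<Rightarrow> int \<Rightarrow> (int \<Rightarrow> int) set" where
  "Psi_minus y r = {z \<in> FZ. covers y z \<and> (\<exists>i<r. z = transpose i r \<circ> y \<circ> transpose i r)}"

definition A_FPF :: "(int \<Rightarrow> int) \<Rightarrow> (int \<Rightarrow> int) set" where
  "A_FPF z = {w \<in> SZ. z = twist w \<and> (\<forall>v\<in>SZ. z = twist v \<longrightarrow> ell w \<le> ell v)}"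

definition R_FPF :: "(int \<Rightarrow> int) \<Rightarrow> int list set" where
  "R_FPF z = (\<Union>w\<in>A_FPF z. reduced_words w)"

text \<open>Positions in words are numbered from \<open>0\<close>, following the list library.\<close>

definition del :: "nat \<Rightarrow> 'a list \<Rightarrow> 'a list" where
  "del i a = take i a @ drop (Suc i) a"

definition marked :: "(int \<Rightarrow> int) \<Rightarrow> int list \<times> nat \<Rightarrow> bool" where
  "marked y = (\<lambda>(a, i). i < length a \<and> del i a \<in> R_FPF y)"

definition is_reduced :: "int list \<times> nat \<Rightarrow> bool" where
  "is_reduced = (\<lambda>(a, i). \<exists>z\<in>FZ. a \<in> R_FPF z)"

definition is_semi_reduced :: "int list \<times> nat \<Rightarrow> bool" where
  "is_semi_reduced = (\<lambda>(a, i). twist (word_prod a) = twist (word_prod (del i a)))"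

text \<open>The functions below are meaningful only on \<open>y\<close>-marked words (respectively, for
  \<open>little_y\<close>, on words of covers of \<open>y\<close>); there the descriptions \<open>THE\<close> and \<open>LEAST\<close> are
  well-defined.\<close>

definition push :: "(int \<Rightarrow> int) \<Rightarrow> int list \<times> nat \<Rightarrow> int list \<times> nat" where
  "push y = (\<lambda>(a, i).
     let b = a[i := a ! i - 1]
     in (b, if is_reduced (b, i) \<or> is_semi_reduced (b, i) then i
            else (THE j. j \<noteq> i \<and> marked y (b, j))))"

definition little :: "(int \<Rightarrow> int) \<Rightarrow> int list \<times> nat \<Rightarrow> int list \<times> nat" where
  "little y m = (push y ^^ (LEAST N. 0 < N \<and> is_reduced ((push y ^^ N) m))) m"

definition little_y :: "(int \<Rightarrow> int) \<Rightarrow> int list \<Rightarrow> int list" where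
  "little_y y a = fst (little y (a, THE i. marked y (a, i) \<and> is_reduced (a, i)))"

end

theory Submission
  imports Defs
begin

text \<open>
  Draw a word as a strand diagram and name every strand by its position at the right end. Each
  letter interchanges two strands, and deleting a letter that interchanges the strands \<open>l\<close> and
  \<open>r\<close> multiplies the product by the transposition \<open>(l, r)\<close> on the right, hence conjugates the
  involution \<open>twist\<close> of the word by \<open>(l, r)\<close>. So a \<open>y\<close>-marked word whose mark interchanges
  \<open>L\<close> and \<open>R\<close>, standing in this order on the right of the mark, is a word for
  \<open>(L, R) y (L, R)\<close>.

  The lengths are controlled by one observation. Call an inversion \<open>(i, j)\<close> of the involution
  \<open>z = twist w\<close> proper if \<open>i\<close> and \<open>j\<close> lie in different cycles; its mirror image
  \<open>(z j, z i)\<close> is then another one. Since \<open>Theta\<close> preserves the order of points in different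
  cycles, \<open>w\<close> inverts exactly one of the two (\<open>proper_inv_half\<close>). Hence \<open>w\<close> has at least
  half as many inversions as \<open>z\<close> has proper ones, with equality exactly if all its inversions
  are proper inversions of \<open>z\<close>. It follows that a marked word is reduced if and only if
  \<open>L < R\<close> and \<open>y L < y R\<close> (\<open>marked_reduced_iff\<close>), and semi-reduced if and only if
  \<open>y L = R\<close>. In all other cases a word of \<open>y\<close> crosses exactly one of the pair
  \<open>{L, R}\<close> and the pair of its partners, at exactly one letter. This letter is the other mark
  (\<open>other_mark_unique\<close>), and there the strands stand in the order \<open>(R, L)\<close> or
  \<open>(y R, y L)\<close> (\<open>mark_orientation\<close>).

  Therefore one step of the Little algorithm is invertible: raise the marked letter again after
  moving the mark back. It also keeps track of a cycle \<open>(p, q)\<close>: if the left strand of the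
  mark is \<open>p\<close> or \<open>q\<close>, lowering the letter makes it the right strand, and moving the mark makes
  it or its partner the left strand again. So the algorithm, started at a reduced word with left
  strand \<open>p\<close> or \<open>q\<close>, stops at a reduced word with right strand \<open>p\<close> or \<open>q\<close>, and it is a
  bijection between words of these two kinds, being the first return map of an invertible map
  (\<open>little_bij\<close>). It stops in both directions because the sum of the letters changes by 1 in each
  step while all unmarked letters stay bounded, and an even marked letter far away from them
  makes the word reduced (\<open>nonreduced_sum_bound\<close>).

  Finally, the reduced words with left strand \<open>p\<close> or \<open>q\<close> are the words of the covers in
  \<open>Psi_plus y q\<close>, because \<open>(q, j)\<close> and \<open>(p, y j)\<close> conjugate \<open>y\<close> in the same way; similarly
  for \<open>Psi_minus y p\<close> (\<open>Psi_words\<close>). Here it is needed that a cover obtained by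
  conjugation with a transposition is longer by exactly 1 (\<open>covers_len\<close>): otherwise either a point
  in between or a pair of cycles side by side yields an element strictly in between, and in the
  remaining cases the proper inversions can be counted.
\<close>

section \<open>Words and the strands that their letters cross\<close>

lemma SZ_bij: "w \<in> SZ \<Longrightarrow> bij w"
  by (simp add: SZ_def)

lemma simple_comp_SZ:
  assumes "w \<in> SZ" shows "simple x \<circ> w \<in> SZ"
proof -
  have "{k. (simple x \<circ> w) k \<noteq> k} \<subseteq> {k. w k \<noteq> k} \<union> {x, x + 1}"
    by (auto simp: simple_def transpose_def split: if_splits)
  moreover have "bij (simple x \<circ> w)"
    using assms by (simp add: SZ_def simple_def bij_comp)
  ultimately show ?thesis
    using assms by (auto simp: SZ_def intro: finite_subset)
qed

lemma word_prod_simps: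
  "word_prod [] = id"
  "word_prod (x # a) = simple x \<circ> word_prod a"
  by (simp_all add: word_prod_def)

lemma word_prod_append: "word_prod (a @ b) = word_prod a \<circ> word_prod b"
proof (induction a)
  case Nil
  show "word_prod ([] @ b) = word_prod [] \<circ> word_prod b" by (simp add: word_prod_simps)
next
  case (Cons x a)
  then show "word_prod ((x # a) @ b) = word_prod (x # a) \<circ> word_prod b"
    by (simp add: word_prod_simps fun_eq_iff)
qed

lemma word_prod_SZ: "word_prod a \<in> SZ"
proof (induction a)
  case Nil
  show "word_prod [] \<in> SZ" by (simp add: SZ_def word_prod_simps)
next
  case (Cons x a)
  then show "word_prod (x # a) \<in> SZ" by (simp add: simple_comp_SZ word_prod_simps)
qed

lemma bij_word_prod [simp]: "bij (word_prod a)"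
  using word_prod_SZ SZ_bij by blast

text \<open>A finitely supported permutation moves points only inside some interval symmetric about 0.\<close>

lemma SZ_bound:
  assumes "w \<in> SZ"
  obtains m where "\<And>i. \<bar>i\<bar> > m \<Longrightarrow> w i = i" "\<And>i. \<bar>i\<bar> \<le> m \<Longrightarrow> \<bar>w i\<bar> \<le> m"
proof -
  define m where "m = Max (abs ` insert 0 {i. w i \<noteq> i})"
  have fin: "finite {i. w i \<noteq> i}" and inj: "inj w"
    using assms by (auto simp: SZ_def bij_is_inj)
  have 1: "w i = i" if "\<bar>i\<bar> > m" for i
  proof (rule ccontr)
    assume "w i \<noteq> i"
    then have "\<bar>i\<bar> \<le> m" unfolding m_def using fin by (intro Max_ge) auto
    then show False using that by simp
  qed
  have 2: "\<bar>w i\<bar> \<le> m" if "\<bar>i\<bar> \<le> m" for i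
  proof (rule ccontr)
    assume *: "\<not> \<bar>w i\<bar> \<le> m"
    then have "w (w i) = w i" using 1 by simp
    then have "w i = i" using inj by (simp add: inj_eq)
    then show False using * that by simp
  qed
  show ?thesis using that[of m] 1 2 by auto
qed

lemma finite_Inv:
  assumes "w \<in> SZ" shows "finite (Inv w)"
proof -
  obtain m where m: "\<And>i. \<bar>i\<bar> > m \<Longrightarrow> w i = i" "\<And>i. \<bar>i\<bar> \<le> m \<Longrightarrow> \<bar>w i\<bar> \<le> m"
    using SZ_bound[OF assms] by blast
  have "Inv w \<subseteq> {-m..m} \<times> {-m..m}"
  proof
    fix x assume "x \<in> Inv w"
    then obtain i j where x: "x = (i, j)" "i < j" "w j < w i" by (auto simp: Inv_def)
    have "\<bar>i\<bar> \<le> m \<and> \<bar>j\<bar> \<le> m"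
      using m[of i] m[of j] x(2,3) by linarith
    then show "x \<in> {-m..m} \<times> {-m..m}" using x by auto
  qed
  then show ?thesis by (rule finite_subset) auto
qed

text \<open>Composing with a simple transposition on the left exchanges the adjacent values \<open>x\<close> and
  \<open>x + 1\<close>, which changes the relative order of the two points carrying these values and
  of no other pair.\<close>

lemma Inv_simple_comp:
  fixes w x
  defines "l \<equiv> inv w x" and "r \<equiv> inv w (x + 1)"
  assumes "bij w"
  shows "l < r \<Longrightarrow> (l, r) \<notin> Inv w \<and> Inv (simple x \<circ> w) = insert (l, r) (Inv w)"
    and "r < l \<Longrightarrow> (r, l) \<in> Inv w \<and> Inv (simple x \<circ> w) = Inv w - {(r, l)}"
    and "l \<noteq> r"
proof -
  have wl: "w i = x \<longleftrightarrow> i = l" and wr: "w i = x + 1 \<longleftrightarrow> i = r" for i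
    using assms(3) by (auto simp: l_def r_def bij_is_surj surj_f_inv_f bij_is_inj inv_f_eq)
  have s: "(simple x \<circ> w) i = (if i = l then x + 1 else if i = r then x else w i)" for i
    using wl[of i] wr[of i] by (auto simp: simple_def transpose_def)
  have lr: "w l = x" "w r = x + 1" using wl wr by auto
  have ne: "w i < x \<or> x + 1 < w i" if "i \<noteq> l" "i \<noteq> r" for i
    using wl[of i] wr[of i] that by linarith
  show "l \<noteq> r" using lr by auto
  show "(l, r) \<notin> Inv w \<and> Inv (simple x \<circ> w) = insert (l, r) (Inv w)" if "l < r"
  proof
    show "(l, r) \<notin> Inv w" using lr by (auto simp: Inv_def)
    show "Inv (simple x \<circ> w) = insert (l, r) (Inv w)"
    proof (rule set_eqI, clarify)
      fix i j
      show "(i, j) \<in> Inv (simple x \<circ> w) \<longleftrightarrow> (i, j) \<in> insert (l, r) (Inv w)"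
        unfolding Inv_def mem_Collect_eq prod.case s
        using that lr ne[of i] ne[of j]
        by (cases "i = l"; cases "i = r"; cases "j = l"; cases "j = r") auto
    qed
  qed
  show "(r, l) \<in> Inv w \<and> Inv (simple x \<circ> w) = Inv w - {(r, l)}" if "r < l"
  proof
    show "(r, l) \<in> Inv w" using lr that by (auto simp: Inv_def)
    show "Inv (simple x \<circ> w) = Inv w - {(r, l)}"
    proof (rule set_eqI, clarify)
      fix i j
      show "(i, j) \<in> Inv (simple x \<circ> w) \<longleftrightarrow> (i, j) \<in> Inv w - {(r, l)}"
        unfolding Inv_def mem_Collect_eq prod.case s
        using that lr ne[of i] ne[of j]
        by (cases "i = l"; cases "i = r"; cases "j = l"; cases "j = r") auto
    qed
  qed
qed

text \<open>The least moved point \<open>i\<close> must move up, and the point sent to \<open>i\<close> must come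
  from above; together they form an inversion.\<close>

lemma SZ_no_Inv:
  assumes "w \<in> SZ" "Inv w = {}" shows "w = id"
proof (rule ccontr)
  assume "w \<noteq> id"
  define X where "X = {i. w i \<noteq> i}"
  have X: "finite X" "X \<noteq> {}" using assms \<open>w \<noteq> id\<close> by (auto simp: X_def SZ_def)
  define i where "i = Min X"
  have i: "w i \<noteq> i" "\<And>j. j < i \<Longrightarrow> w j = j"
    using Min_in[OF X] Min_le[OF X(1)] by (auto simp: i_def X_def) (meson leD)
  obtain j where j: "w j = i" using assms by (metis SZ_bij bij_pointE)
  have inj: "inj w" using assms by (simp add: SZ_def bij_is_inj)
  have "\<not> w i < i" using i inj by (metis injD)
  moreover have "i < j" using i j by (metis linorder_neqE)
  ultimately have "(i, j) \<in> Inv w" using i j by (auto simp: Inv_def)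
  then show False using assms by simp
qed

text \<open>If no two adjacent values were in the wrong order, the inverse permutation would be increasing;
  so some simple transposition removes exactly one inversion.\<close>

lemma exists_reduced_word:
  assumes "w \<in> SZ" shows "\<exists>a. word_prod a = w \<and> length a = ell w"
  using assms
proof (induction "ell w" arbitrary: w)
  case 0
  then have "Inv w = {}" using finite_Inv by (simp add: ell_def)
  then have "w = id" using SZ_no_Inv 0 by blast
  then show ?case using 0 by (intro exI[of _ "[]"]) (simp add: word_prod_simps)
next
  case (Suc n)
  have bw: "bij w" using Suc by (simp add: SZ_bij)
  have "\<exists>x. inv w (x + 1) < inv w x"
  proof (rule ccontr)
    assume "\<nexists>x. inv w (x + 1) < inv w x"
    then have step: "inv w x < inv w (x + 1)" for x
      using Inv_simple_comp(3)[OF bw, of x] by (metis linorder_neqE)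
    have mono: "inv w x < inv w x'" if "x < x'" for x x'
      using that by (induction rule: int_gr_induct) (auto intro: step less_trans)
    have "Inv w = {}"
    proof (rule ccontr)
      assume "Inv w \<noteq> {}"
      then obtain i j where "i < j" "w j < w i" by (auto simp: Inv_def)
      then show False using mono[of "w j" "w i"] bw by (simp add: bij_is_inj)
    qed
    then show False using Suc by (simp add: ell_def)
  qed
  then obtain x where x: "inv w (x + 1) < inv w x" by blast
  define w' where "w' = simple x \<circ> w"
  have "w' \<in> SZ" using Suc by (simp add: w'_def simple_comp_SZ)
  moreover have "n = ell w'"
    using Inv_simple_comp(2)[OF bw x] Suc(2) finite_Inv[OF Suc(3)] by (auto simp: ell_def w'_def)
  ultimately obtain a where "word_prod a = w'" "length a = ell w'" using Suc(1) by blast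
  then have "word_prod (x # a) = w" "length (x # a) = ell w"
    using \<open>n = ell w'\<close> Suc(2) by (auto simp: w'_def simple_def fun_eq_iff word_prod_simps)
  then show ?case by blast
qed

text \<open>Draw a word as a strand diagram in which every letter \<open>x\<close> interchanges the strands at
  positions \<open>x\<close> and \<open>x + 1\<close>, and name each strand by its position at the right end
  of the word. The label of a letter is the ordered pair of the names of the two strands that it
  interchanges, in the order in which they stand on the right of the letter.\<close>

fun labels :: "int list \<Rightarrow> (int \<times> int) list" where
  "labels [] = []"
| "labels (x # a) = (inv (word_prod a) x, inv (word_prod a) (x + 1)) # labels a"

lemma length_labels [simp]: "length (labels a) = length a"
  by (induction a) auto

lemma labels_append:
  "labels (a @ b) = map (map_prod (inv (word_prod b)) (inv (word_prod b))) (labels a) @ labels b"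
proof (induction a)
  case (Cons x a)
  have "inv (word_prod (a @ b)) = inv (word_prod b) \<circ> inv (word_prod a)"
    by (simp add: word_prod_append o_inv_distrib)
  then show ?case using Cons by simp
qed simp

lemma labels_neq: "(l, r) \<in> set (labels a) \<Longrightarrow> l \<noteq> r"
  by (induction a) (auto simp: Inv_simple_comp(3))

text \<open>An inversion is created only by a letter at which its two strands meet; since the last such
  letter on the way to the left creates it, the names stand there in increasing order.\<close>

lemma Inv_subset_labels: "Inv (word_prod a) \<subseteq> set (labels a)"
proof (induction a)
  case Nil
  show "Inv (word_prod []) \<subseteq> set (labels [])" by (simp add: Inv_def word_prod_simps)
next
  case (Cons x a)
  have "Inv (simple x \<circ> word_prod a) \<subseteq> set (labels (x # a))"
    using Inv_simple_comp[of "word_prod a" x] Cons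
    by (cases "inv (word_prod a) x" "inv (word_prod a) (x+1)" rule: linorder_cases) auto
  then show "Inv (word_prod (x # a)) \<subseteq> set (labels (x # a))"
    by (simp only: word_prod_simps)
qed

lemma ell_le_length: "ell (word_prod a) \<le> length a"
  using card_mono[OF _ Inv_subset_labels[of a]] card_length[of "labels a"] by (simp add: ell_def)

text \<open>There are at least as many labels as inversions, so in a reduced word every label is an
  inversion and no label is repeated.\<close>

lemma reduced_labels:
  assumes "length a = ell (word_prod a)"
  shows "set (labels a) = Inv (word_prod a)" "distinct (labels a)"
proof -
  have "card (set (labels a)) \<le> card (Inv (word_prod a))"
    using card_length[of "labels a"] assms by (simp add: ell_def)
  then show *: "set (labels a) = Inv (word_prod a)"
    using Inv_subset_labels[of a] by (metis card_seteq List.finite_set)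
  show "distinct (labels a)"
    using assms by (intro card_distinct) (simp add: * ell_def)
qed

lemma ell_simple_comp_le: "w \<in> SZ \<Longrightarrow> ell (simple x \<circ> w) \<le> Suc (ell w)"
proof -
  assume "w \<in> SZ"
  then obtain a where a: "word_prod a = w" "length a = ell w" using exists_reduced_word by blast
  show ?thesis using ell_le_length[of "x # a"] by (simp add: a word_prod_simps)
qed

lemma ell_append_le: "ell (word_prod (a @ b)) \<le> length a + ell (word_prod b)"
proof (induction a)
  case (Cons x a)
  then show "ell (word_prod ((x # a) @ b)) \<le> length (x # a) + ell (word_prod b)"
    using ell_simple_comp_le[OF word_prod_SZ[of "a @ b"], of x]
    by (simp add: word_prod_simps)
qed simp

lemma reduced_suffix:
  assumes "length (a @ b) = ell (word_prod (a @ b))"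
  shows "length b = ell (word_prod b)"
  using ell_append_le[of a b] ell_le_length[of b] assms by simp

lemma labels_nth:
  "j < length b \<Longrightarrow> labels b ! j =
    (inv (word_prod (drop (Suc j) b)) (b ! j), inv (word_prod (drop (Suc j) b)) (b ! j + 1))"
proof (induction b arbitrary: j)
  case (Cons x b)
  then show ?case by (cases j) auto
qed simp

lemma bij_conj_transpose:
  "bij f \<Longrightarrow> transpose (f a) (f b) \<circ> f = f \<circ> transpose a b"
  by (auto simp: fun_eq_iff transpose_def bij_is_inj inj_eq)

text \<open>A letter acting on the left of \<open>S\<close> is the same as the transposition of the two strand names
  acting on the right.\<close>

lemma simple_comp_labels:
  assumes "bij S"
  shows "simple x \<circ> S = S \<circ> transpose (inv S x) (inv S (x + 1))"
  using bij_conj_transpose[OF assms, of "inv S x" "inv S (x + 1)"] assms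
  by (simp add: simple_def bij_is_surj surj_f_inv_f)

lemma word_prod_del:
  assumes "j < length b" "labels b ! j = (l, r)"
  shows "word_prod (del j b) = word_prod b \<circ> transpose l r"
    and "word_prod b = word_prod (del j b) \<circ> transpose l r"
proof -
  define S where "S = word_prod (drop (Suc j) b)"
  have b: "b = take j b @ b ! j # drop (Suc j) b" using assms by (simp add: id_take_nth_drop)
  have lr: "l = inv S (b ! j)" "r = inv S (b ! j + 1)"
    using assms labels_nth[of j b] by (auto simp: S_def)
  have "word_prod b = word_prod (take j b) \<circ> (simple (b ! j) \<circ> S)"
    by (subst b) (simp only: word_prod_append word_prod_simps S_def)
  also have "\<dots> = word_prod (del j b) \<circ> transpose l r"
    using simple_comp_labels[of S "b ! j"] by (simp add: S_def lr del_def word_prod_append comp_assoc)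
  finally show *: "word_prod b = word_prod (del j b) \<circ> transpose l r" .
  show "word_prod (del j b) = word_prod b \<circ> transpose l r"
    by (simp add: * comp_assoc)
qed

lemma length_del: "j < length b \<Longrightarrow> length (del j b) = length b - 1"
  by (simp add: del_def)

text \<open>The letters to the right of a deleted letter keep their labels, because names refer to the right
  end. For the letters to its left, the two strands \<open>L\<close> and \<open>R\<close> have traded places.\<close>

lemma labels_del:
  assumes "i < length b" "labels b ! i = (L, R)"
  shows "labels b = map (map_prod (transpose L R) (transpose L R)) (take i (labels (del i b)))
           @ (L, R) # drop i (labels (del i b))"
proof -
  define S where "S = word_prod (drop (Suc i) b)"
  have b: "b = take i b @ b ! i # drop (Suc i) b" using assms by (simp add: id_take_nth_drop)
  have LR: "L = inv S (b ! i)" "R = inv S (b ! i + 1)"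
    using assms labels_nth[of i b] by (auto simp: S_def)
  have bS: "bij S" by (simp add: S_def)
  have "inv (simple (b ! i) \<circ> S) = inv (S \<circ> transpose L R)"
    using simple_comp_labels[OF bS] LR by simp
  also have "\<dots> = transpose L R \<circ> inv S" using bS by (simp add: o_inv_distrib)
  finally have inv: "inv (simple (b ! i) \<circ> S) = transpose L R \<circ> inv S" .
  have d: "labels (del i b) = map (map_prod (inv S) (inv S)) (labels (take i b)) @ labels (drop (Suc i) b)"
    by (simp add: del_def labels_append S_def)
  have parts: "take i (labels (del i b)) = map (map_prod (inv S) (inv S)) (labels (take i b))"
    "drop i (labels (del i b)) = labels (drop (Suc i) b)"
    using assms(1) by (simp_all add: d)
  have "labels b = map (map_prod (inv (simple (b ! i) \<circ> S)) (inv (simple (b ! i) \<circ> S))) (labels (take i b))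
     @ (L, R) # labels (drop (Suc i) b)"
    by (subst b, subst labels_append) (simp add: LR S_def word_prod_simps)
  also have "\<dots> = map (map_prod (transpose L R) (transpose L R)) (take i (labels (del i b)))
           @ (L, R) # drop i (labels (del i b))"
    unfolding inv parts by (simp add: map_prod.comp)
  finally show ?thesis .
qed

lemma strong_exchange:
  assumes "length a = ell (word_prod a)" "(l, r) \<in> Inv (word_prod a)"
  obtains j where "j < length a" "labels a ! j = (l, r)"
    "word_prod (del j a) = word_prod a \<circ> transpose l r"
proof -
  have "(l, r) \<in> set (labels a)" using reduced_labels(1)[OF assms(1)] assms(2) by simp
  then obtain j where j: "j < length a" "labels a ! j = (l, r)" by (auto simp: in_set_conv_nth)
  show ?thesis by (rule that[OF j word_prod_del(1)[OF j]])
qed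

text \<open>Removing the letter of a reduced word at which strands \<open>i\<close> and \<open>j\<close> cross realises the
  transposition.\<close>

lemma ell_transpose_less:
  assumes "w \<in> SZ" "(i, j) \<in> Inv w"
  shows "ell (w \<circ> transpose i j) < ell w"
proof -
  obtain a where a: "word_prod a = w" "length a = ell w" using exists_reduced_word assms by blast
  have "length a = ell (word_prod a)" "(i, j) \<in> Inv (word_prod a)" using a assms by simp_all
  then obtain k where "k < length a" "word_prod (del k a) = word_prod a \<circ> transpose i j"
    by (rule strong_exchange)
  then have k: "k < length a" "word_prod (del k a) = w \<circ> transpose i j" using a by simp_all
  then have "ell (w \<circ> transpose i j) \<le> length a - 1"
    using ell_le_length[of "del k a"] by (simp add: length_del)
  then show ?thesis using a k by simp
qed

section \<open>Length of fixed-point-free involutions\<close>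

lemma Theta_neq: "Theta i \<noteq> i"
  by (simp add: Theta_parity)

lemma Theta_Theta [simp]: "Theta (Theta i) = i"
  by (simp add: Theta_parity)

text \<open>The cycles of \<open>Theta\<close> consist of adjacent integers, so it preserves the order of any two
  points that are not partners.\<close>

lemma Theta_mono: "i < j \<Longrightarrow> Theta i \<noteq> j \<Longrightarrow> Theta i < Theta j"
  by (cases "even i"; cases "even j") (auto simp: Theta_parity, presburger)

lemma twist_eq: "w \<in> SZ \<Longrightarrow> w (twist w i) = Theta (w i)"
  by (simp add: twist_def SZ_bij bij_is_surj surj_f_inv_f)

lemma twist_involution: "w \<in> SZ \<Longrightarrow> twist w (twist w i) = i"
  by (simp add: twist_def SZ_bij bij_is_surj bij_is_inj surj_f_inv_f)

lemma twist_neq: "w \<in> SZ \<Longrightarrow> twist w i \<noteq> i"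
  using twist_eq[of w i] Theta_neq[of "w i"] by auto

lemma twist_FZ: "w \<in> SZ \<Longrightarrow> twist w \<in> FZ"
  by (simp add: FZ_def)

lemma twist_comp_transpose:
  "w \<in> SZ \<Longrightarrow> twist (w \<circ> transpose i j) = transpose i j \<circ> twist w \<circ> transpose i j"
  by (simp add: twist_def SZ_bij o_inv_distrib comp_assoc)

lemma FZ_involution [simp]: "y \<in> FZ \<Longrightarrow> y (y i) = i"
  by (auto simp: FZ_def twist_involution)

lemma FZ_neq: "y \<in> FZ \<Longrightarrow> y i \<noteq> i"
  by (auto simp: FZ_def twist_neq)

lemma FZ_eq_iff [simp]: "y \<in> FZ \<Longrightarrow> y i = y j \<longleftrightarrow> i = j"
  by (metis FZ_involution)

text \<open>The inversions of an involution that do not come from the two points of one cycle. They come in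
  pairs, interchanged by \<open>mirror\<close> below, so that \<open>fpf_len\<close> is an integer version of
  \<open>ell_FPF\<close>.\<close>

definition proper_inv :: "(int \<Rightarrow> int) \<Rightarrow> (int \<times> int) set" where
  "proper_inv z = {(i, j). i < j \<and> z j < z i \<and> z i \<noteq> j}"

lemma Inv_minus_Cyc: "Inv z - Cyc z = proper_inv z"
  by (auto simp: Inv_def Cyc_def proper_inv_def)

definition fpf_len :: "(int \<Rightarrow> int) \<Rightarrow> nat" where
  "fpf_len z = card (proper_inv z) div 2"

definition mirror :: "(int \<Rightarrow> int) \<Rightarrow> int \<times> int \<Rightarrow> int \<times> int" where
  "mirror z = (\<lambda>(i, j). (z j, z i))"

lemma mirror_apply [simp]: "mirror z (i, j) = (z j, z i)"
  by (simp add: mirror_def)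

lemma mirror_proper_inv: "z \<in> FZ \<Longrightarrow> mirror z e \<in> proper_inv z \<longleftrightarrow> e \<in> proper_inv z"
  by (cases e) (auto simp: proper_inv_def mirror_def)

lemma mirror_mirror: "z \<in> FZ \<Longrightarrow> mirror z (mirror z e) = e"
  by (cases e) (auto simp: mirror_def)

text \<open>The permutation \<open>w\<close> carries \<open>z\<close> to \<open>Theta\<close>, which preserves the order of
  points in different cycles. Hence \<open>w\<close> orders the partners \<open>z i\<close> and \<open>z j\<close>
  in the same way as \<open>i\<close> and \<open>j\<close>, although \<open>z\<close> reverses them; so \<open>w\<close> inverts
  exactly one of a proper inversion and its mirror image.\<close>

lemma proper_inv_half:
  assumes "w \<in> SZ" "z = twist w" "e \<in> proper_inv z"
  shows "mirror z e \<in> Inv w \<longleftrightarrow> e \<notin> Inv w"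
proof -
  obtain i j where e: "e = (i, j)" "i < j" "z j < z i" "z i \<noteq> j"
    using assms(3) by (auto simp: proper_inv_def)
  have inj: "inj w" using assms by (simp add: SZ_bij bij_is_inj)
  have z: "w (z i) = Theta (w i)" "w (z j) = Theta (w j)" using assms by (simp_all add: twist_eq)
  have "w i \<noteq> w j" using e inj by (auto simp: inj_eq)
  have "Theta (w i) \<noteq> w j" using z(1) e inj by (auto simp: inj_eq)
  then have "Theta (w j) \<noteq> w i" by (metis Theta_Theta)
  have "w (z i) < w (z j) \<longleftrightarrow> w i < w j"
  proof (cases "w i < w j")
    case True
    then show ?thesis using Theta_mono[OF True \<open>Theta (w i) \<noteq> w j\<close>] z by simp
  next
    case False
    then have "w j < w i" using \<open>w i \<noteq> w j\<close> by simp
    then show ?thesis using Theta_mono[OF _ \<open>Theta (w j) \<noteq> w i\<close>] z by simp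
  qed
  then show ?thesis using e \<open>w i \<noteq> w j\<close> by (auto simp: Inv_def)
qed

text \<open>By the preceding lemma, \<open>w\<close> inverts exactly half of the proper inversions of \<open>twist w\<close>.\<close>

lemma proper_inv_card:
  assumes "w \<in> SZ" "z = twist w"
  shows "finite (proper_inv z)" "card (proper_inv z) = 2 * card (proper_inv z \<inter> Inv w)"
proof -
  have zF: "z \<in> FZ" using assms twist_FZ by blast
  let ?I = "proper_inv z \<inter> Inv w"
  have eq: "proper_inv z = ?I \<union> mirror z ` ?I"
  proof (intro equalityI subsetI)
    fix e assume e: "e \<in> proper_inv z"
    show "e \<in> ?I \<union> mirror z ` ?I"
    proof (cases "e \<in> Inv w")
      case False
      then have "mirror z e \<in> ?I" using proper_inv_half[OF assms e] mirror_proper_inv[OF zF] e by blast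
      then show ?thesis using mirror_mirror[OF zF, of e] by (metis UnI2 imageI)
    qed (use e in auto)
  qed (use mirror_proper_inv[OF zF] in blast)
  have fin: "finite ?I" using finite_Inv assms by blast
  then show "finite (proper_inv z)" using eq by (metis finite_Un finite_imageI)
  have inj: "inj_on (mirror z) ?I" by (rule inj_on_inverseI) (rule mirror_mirror[OF zF])
  have "?I \<inter> mirror z ` ?I = {}" using proper_inv_half[OF assms] by blast
  then have "card (proper_inv z) = card ?I + card (mirror z ` ?I)"
    using eq fin by (metis card_Un_disjoint finite_imageI)
  then show "card (proper_inv z) = 2 * card ?I" using inj by (simp add: card_image)
qed

lemma finite_proper_inv: "z \<in> FZ \<Longrightarrow> finite (proper_inv z)"
  by (auto simp: FZ_def proper_inv_card)

lemma ell_FPF_fpf_len: "z \<in> FZ \<Longrightarrow> ell_FPF z = of_nat (fpf_len z)"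
  using proper_inv_card(2) by (fastforce simp: FZ_def ell_FPF_def fpf_len_def Inv_minus_Cyc)

lemma fpf_len_le_ell: "w \<in> SZ \<Longrightarrow> fpf_len (twist w) \<le> ell w"
  using proper_inv_card(2)[of w] card_mono[OF finite_Inv, of w "proper_inv (twist w) \<inter> Inv w"]
  by (simp add: fpf_len_def ell_def)

lemma fpf_len_eq_iff: "w \<in> SZ \<Longrightarrow> ell w = fpf_len (twist w) \<longleftrightarrow> Inv w \<subseteq> proper_inv (twist w)"
proof
  assume w: "w \<in> SZ"
  have len: "fpf_len (twist w) = card (proper_inv (twist w) \<inter> Inv w)"
    using proper_inv_card(2)[OF w refl] by (simp add: fpf_len_def)
  show "Inv w \<subseteq> proper_inv (twist w)" if "ell w = fpf_len (twist w)"
    using card_subset_eq[of "Inv w" "proper_inv (twist w) \<inter> Inv w"] finite_Inv[OF w] that len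
    by (auto simp: ell_def)
  show "ell w = fpf_len (twist w)" if "Inv w \<subseteq> proper_inv (twist w)"
    using len that by (simp add: Int_absorb1 ell_def)
qed

text \<open>An inversion of \<open>w\<close> that is not a proper inversion of \<open>z = twist w\<close> is wasteful. If
  its points form a cycle of \<open>z\<close>, undoing it changes nothing in \<open>z\<close>. Otherwise the
  partners of its points are inverted by \<open>w\<close> as well, and undoing both inversions
  conjugates \<open>z\<close> by two transpositions whose effects cancel.\<close>

lemma shorter_twist:
  assumes "w \<in> SZ" "\<not> Inv w \<subseteq> proper_inv (twist w)"
  shows "\<exists>v\<in>SZ. twist v = twist w \<and> ell v < ell w"
proof -
  define z where "z = twist w"
  have zF: "z \<in> FZ" using assms by (simp add: z_def twist_FZ)
  obtain i j where ij: "i < j" "w j < w i" "\<not> (z j < z i \<and> z i \<noteq> j)"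
    using assms(2) by (auto simp: Inv_def proper_inv_def z_def)
  then have inv: "(i, j) \<in> Inv w" by (simp add: Inv_def)
  define v where "v = w \<circ> transpose i j"
  have v: "v \<in> SZ" "ell v < ell w" "twist v = transpose i j \<circ> z \<circ> transpose i j"
    using transpose_comp_SZ assms(1) ell_transpose_less[OF assms(1) inv]
      twist_comp_transpose[OF assms(1)] by (auto simp: v_def z_def)
  show ?thesis
  proof (cases "z i = j")
    case True
    then have "z j = i" using zF by auto
    then have "twist v = z" unfolding v(3) using True zF
      by (auto simp: fun_eq_iff transpose_def)
    then show ?thesis using v by (auto simp: z_def)
  next
    case False
    then have lt: "z i < z j" using ij zF by (metis FZ_eq_iff linorder_neqE order_less_irrefl)
    have ne: "z i \<noteq> i" "z j \<noteq> j" "z j \<noteq> i" using False zF FZ_neq by auto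
    define u where "u = v \<circ> transpose (z i) (z j)"
    have wz: "w (z i) = Theta (w i)" "w (z j) = Theta (w j)"
      using assms(1) by (simp_all add: twist_eq z_def)
    have "Theta (w j) < Theta (w i)"
    proof (rule Theta_mono[OF ij(2)])
      show "Theta (w j) \<noteq> w i" using wz(2) ne(3) SZ_bij[OF assms(1)] by (metis bij_is_inj injD)
    qed
    then have "(z i, z j) \<in> Inv v" using lt ne False wz by (simp add: Inv_def v_def transpose_def)
    then have "ell u < ell v" using ell_transpose_less v by (simp add: u_def)
    moreover have "u \<in> SZ" using v transpose_comp_SZ by (simp add: u_def)
    moreover have "twist u = z"
    proof -
      have "twist u = transpose (z i) (z j) \<circ> (transpose i j \<circ> z \<circ> transpose i j) \<circ> transpose (z i) (z j)"
        using v twist_comp_transpose by (simp add: u_def)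
      also have "\<dots> = z" using zF ne False
        by (auto simp: fun_eq_iff transpose_def)
      finally show ?thesis .
    qed
    ultimately show ?thesis using v(2) by (auto simp: z_def)
  qed
qed

text \<open>A shortest permutation with the given twist has no wasteful inversion. Such
  permutations are known as the atoms of \<open>z\<close>.\<close>

lemma exists_atom:
  assumes "z \<in> FZ"
  obtains w where "w \<in> SZ" "twist w = z" "ell w = fpf_len z" "Inv w \<subseteq> proper_inv z"
proof -
  let ?P = "\<lambda>w. w \<in> SZ \<and> twist w = z"
  obtain w0 where "?P w0" using assms by (auto simp: FZ_def)
  then obtain w where w: "?P w" "\<And>v. ?P v \<Longrightarrow> ell w \<le> ell v"
    using ex_has_least_nat[of ?P w0 ell] by blast
  then have "Inv w \<subseteq> proper_inv z" using shorter_twist[of w] by (metis not_less)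
  then show ?thesis using that w fpf_len_eq_iff[of w] by auto
qed

lemma A_FPF_iff: "w \<in> A_FPF z \<longleftrightarrow> w \<in> SZ \<and> z = twist w \<and> ell w = fpf_len z"
proof
  assume "w \<in> A_FPF z"
  then have w: "w \<in> SZ" "z = twist w" "\<And>v. v \<in> SZ \<Longrightarrow> z = twist v \<Longrightarrow> ell w \<le> ell v"
    by (auto simp: A_FPF_def)
  have "z \<in> FZ" using w twist_FZ by simp
  then obtain v where "v \<in> SZ" "twist v = z" "ell v = fpf_len z" "Inv v \<subseteq> proper_inv z"
    by (rule exists_atom)
  then show "w \<in> SZ \<and> z = twist w \<and> ell w = fpf_len z"
    using w(1,2) w(3)[of v] fpf_len_le_ell[OF w(1)] by simp
next
  assume "w \<in> SZ \<and> z = twist w \<and> ell w = fpf_len z"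
  then show "w \<in> A_FPF z" using fpf_len_le_ell by (auto simp: A_FPF_def)
qed

text \<open>Involution words are thus described without reference to the permutations that they spell: they
  are the words of minimal length among those with a given twist.\<close>

lemma R_FPF_iff: "a \<in> R_FPF z \<longleftrightarrow> twist (word_prod a) = z \<and> length a = fpf_len z"
  using fpf_len_le_ell[OF word_prod_SZ[of a]] ell_le_length[of a] word_prod_SZ[of a]
  by (auto simp: R_FPF_def reduced_words_def A_FPF_iff)

lemma R_FPF_reduced:
  assumes "a \<in> R_FPF z"
  shows "length a = ell (word_prod a)" "Inv (word_prod a) \<subseteq> proper_inv z"
    "set (labels a) = Inv (word_prod a)" "distinct (labels a)"
proof -
  have a: "twist (word_prod a) = z" "length a = fpf_len z" using assms by (auto simp: R_FPF_iff)
  show 1: "length a = ell (word_prod a)"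
    using a fpf_len_le_ell[OF word_prod_SZ[of a]] ell_le_length[of a] by simp
  show "Inv (word_prod a) \<subseteq> proper_inv z" using fpf_len_eq_iff[OF word_prod_SZ[of a]] a 1 by simp
  show "set (labels a) = Inv (word_prod a)" "distinct (labels a)" using reduced_labels[OF 1] by auto
qed

lemma fpf_len_le_length: "fpf_len (twist (word_prod a)) \<le> length a"
  using fpf_len_le_ell[OF word_prod_SZ[of a]] ell_le_length[of a] by simp

section \<open>Conjugation by transpositions and Bruhat covers\<close>

definition conj_by :: "int \<Rightarrow> int \<Rightarrow> (int \<Rightarrow> int) \<Rightarrow> int \<Rightarrow> int" where
  "conj_by i j y = transpose i j \<circ> y \<circ> transpose i j"

lemma conj_by_FZ: "y \<in> FZ \<Longrightarrow> conj_by i j y \<in> FZ"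
  by (simp add: conj_by_def transpose_conj_FZ)

lemma conj_by_commute: "conj_by i j y = conj_by j i y"
  by (simp add: conj_by_def transpose_commute)

lemma conj_by_conj_by [simp]: "conj_by i j (conj_by i j y) = y"
  by (simp add: conj_by_def fun_eq_iff)

lemma conj_by_partner:
  assumes "y \<in> FZ" shows "conj_by i (y i) y = y"
  using assms by (auto simp: conj_by_def fun_eq_iff transpose_def)

text \<open>Conjugating by \<open>(i, j)\<close> recombines the cycles \<open>{i, y i}\<close> and \<open>{j, y j}\<close> into
  \<open>{i, y j}\<close> and \<open>{j, y i}\<close>; exchanging the other two endpoints has the same result.\<close>

lemma conj_by_mirror:
  assumes "y \<in> FZ" shows "conj_by (y i) (y j) y = conj_by i j y"
proof (cases "i = j \<or> y i = j")
  case True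
  then show ?thesis
  proof
    assume "y i = j"
    then have "y j = i" using assms by auto
    then show ?thesis using \<open>y i = j\<close> conj_by_commute[of j i y] by simp
  qed (simp add: conj_by_def)
next
  case False
  then have "y j \<noteq> i" "y i \<noteq> i" "y j \<noteq> j" using assms FZ_neq by auto
  then show ?thesis using False assms
    by (auto simp: conj_by_def fun_eq_iff transpose_def)
qed

lemma conj_by_apply:
  assumes "y \<in> FZ" "i \<noteq> j" "y i \<noteq> j"
  shows "conj_by i j y i = y j" "conj_by i j y j = y i" "conj_by i j y (y i) = j"
    "conj_by i j y (y j) = i" "k \<notin> {i, j, y i, y j} \<Longrightarrow> conj_by i j y k = y k"
proof -
  have "y j \<noteq> i" "y i \<noteq> i" "y j \<noteq> j" using assms FZ_neq by auto
  then show "conj_by i j y i = y j" "conj_by i j y j = y i" "conj_by i j y (y i) = j"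
    "conj_by i j y (y j) = i" using assms by (auto simp: conj_by_def transpose_def)
  show "conj_by i j y k = y k" if "k \<notin> {i, j, y i, y j}"
  proof -
    have "y k \<noteq> i" "y k \<noteq> j" using that assms by (metis FZ_involution insertCI)+
    then show ?thesis using that by (auto simp: conj_by_def transpose_def)
  qed
qed

text \<open>The pair \<open>(i, j)\<close> is a proper inversion of the conjugate \<open>z\<close>, so a shortest \<open>w\<close>
  with twist \<open>z\<close> inverts it or its mirror image. Undoing that inversion shortens \<open>w\<close> and
  leads back to \<open>y\<close>.\<close>

lemma fpf_len_conj_less:
  assumes y: "y \<in> FZ" and "i < j" "y i < y j"
  shows "fpf_len y < fpf_len (conj_by i j y)"
proof -
  define z where "z = conj_by i j y"
  have zF: "z \<in> FZ" using y by (simp add: z_def conj_by_FZ)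
  have yz: "y = conj_by i j z" by (simp add: z_def)
  have ne: "y i \<noteq> j" using assms y by (metis FZ_involution less_asym)
  then have "z i = y j" "z j = y i" using conj_by_apply(1,2)[OF y _ ne] assms by (auto simp: z_def)
  then have "(i, j) \<in> proper_inv z" using assms y FZ_neq[OF y] by (auto simp: proper_inv_def)
  obtain w where w: "w \<in> SZ" "twist w = z" "ell w = fpf_len z" "Inv w \<subseteq> proper_inv z"
    using zF by (rule exists_atom)
  have "\<exists>a b. (a, b) \<in> Inv w \<and> y = conj_by a b z"
  proof (cases "(i, j) \<in> Inv w")
    case False
    then have "(z j, z i) \<in> Inv w" using proper_inv_half[of w z "(i,j)"] w \<open>(i, j) \<in> proper_inv z\<close> by simp
    then show ?thesis using yz conj_by_mirror[OF zF] conj_by_commute by metis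
  qed (use yz in auto)
  then obtain a b where ab: "(a, b) \<in> Inv w" "y = conj_by a b z" by blast
  have "fpf_len y \<le> ell (w \<circ> transpose a b)"
    using fpf_len_le_ell[OF transpose_comp_SZ[OF w(1), of a b]] twist_comp_transpose[OF w(1), of a b] ab w
    by (simp add: conj_by_def)
  also have "\<dots> < fpf_len z" using ell_transpose_less[OF w(1) ab(1)] w by simp
  finally show ?thesis by (simp add: z_def)
qed

lemma fpf_len_conj_greater:
  assumes y: "y \<in> FZ" and "(i, j) \<in> proper_inv y"
  shows "fpf_len (conj_by i j y) < fpf_len y"
proof -
  have *: "i < j" "y j < y i" "y i \<noteq> j" using assms by (auto simp: proper_inv_def)
  then have "conj_by i j y i < conj_by i j y j" using conj_by_apply[OF y _ *(3)] by simp
  then show ?thesis using fpf_len_conj_less[OF conj_by_FZ[OF y] *(1), of i j] by simp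
qed

lemma conj_by_up:
  assumes y: "y \<in> FZ" and ij: "i < j" and len: "fpf_len y < fpf_len (conj_by i j y)"
  shows "y i < y j"
proof -
  have "y i \<noteq> j" using len conj_by_partner[OF y, of i] by auto
  moreover have "(i, j) \<notin> proper_inv y" using fpf_len_conj_greater[OF y, of i j] len by linarith
  ultimately show ?thesis using ij FZ_eq_iff[OF y, of i j] by (auto simp: proper_inv_def)
qed

lemma bruhat_le_len:
  assumes "y \<in> FZ" "bruhat_le y z" shows "y = z \<or> fpf_len y < fpf_len z"
  using bruhat_le_ell[OF assms(2)] bruhat_le_FZ[OF assms(2,1)] assms(1) by (simp add: ell_FPF_fpf_len)

lemma bruhat_step_conj:
  "y \<in> FZ \<Longrightarrow> i < j \<Longrightarrow> y i < y j \<Longrightarrow> bruhat_step y (conj_by i j y)"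
  unfolding bruhat_step_def
  using fpf_len_conj_less[of y i j]
  by (auto simp: ell_FPF_fpf_len conj_by_FZ) (auto simp: conj_by_def intro: exI[of _ i])

text \<open>Lengths are integers and increase strictly along the Bruhat order.\<close>

lemma covers_if_len:
  assumes "y \<in> FZ" "i < j" "y i < y j" "fpf_len (conj_by i j y) = Suc (fpf_len y)"
  shows "covers y (conj_by i j y)"
proof -
  let ?z = "conj_by i j y"
  have "bruhat_less y ?z"
    using bruhat_step_conj[OF assms(1-3)] assms(4) by (auto simp: bruhat_less_def bruhat_le_def)
  moreover have "w = y" if "w \<in> FZ" "bruhat_le y w" "bruhat_less w ?z" for w
    using that bruhat_le_len[OF assms(1) that(2)] bruhat_le_len[OF that(1), of ?z] assms(4)
    by (auto simp: bruhat_less_def)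
  ultimately show ?thesis using assms(1) by (auto simp: covers_def bruhat_le_def)
qed

lemma not_covers:
  assumes "y \<in> FZ" "bruhat_step y w" "bruhat_step\<^sup>+\<^sup>+ w z"
  shows "\<not> covers y z"
proof
  assume c: "covers y z"
  have le: "bruhat_le y w" "bruhat_le w z" using assms by (auto simp: bruhat_le_def tranclp_into_rtranclp)
  have wF: "w \<in> FZ" using bruhat_le_FZ[OF le(1) assms(1)] .
  have "y \<noteq> w" using assms(2) by (auto simp: bruhat_step_def)
  moreover have "w \<noteq> z"
  proof -
    obtain v where v: "bruhat_step w v" "bruhat_le v z" using assms(3)
      by (metis bruhat_le_def tranclpD)
    then have "ell_FPF w < ell_FPF v" by (auto simp: bruhat_step_def)
    then show ?thesis using bruhat_le_ell[OF v(2)] by auto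
  qed
  ultimately have "w \<in> {w \<in> FZ. bruhat_le y w \<and> bruhat_less w z}" "w \<noteq> y"
    using le wF by (auto simp: bruhat_less_def)
  then show False using c by (auto simp: covers_def)
qed

lemma conj_by_braid:
  assumes "i \<noteq> e" "i \<noteq> j" "e \<noteq> j"
  shows "conj_by e j (conj_by i j (conj_by i e y)) = conj_by i j y"
    and "conj_by e j (conj_by i e (conj_by e j y)) = conj_by i j y"
proof -
  have "transpose e j (transpose i j (transpose i e k)) = transpose i j k"
    "transpose i e (transpose i j (transpose e j k)) = transpose i j k"
    "transpose e j (transpose i e (transpose e j k)) = transpose i j k" for k
    using assms by (simp_all add: transpose_def)
  then show "conj_by e j (conj_by i j (conj_by i e y)) = conj_by i j y"
    and "conj_by e j (conj_by i e (conj_by e j y)) = conj_by i j y"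
    by (simp_all add: conj_by_def fun_eq_iff)
qed

text \<open>The usual chain of three transpositions that replaces one transposition across an
  intermediate point. Since \<open>y\<close> is an involution, it must be checked that the three points are
  not partners of each other, which the order of their values ensures.\<close>

lemma not_covers_between:
  assumes y: "y \<in> FZ" and "i < e" "e < j" "y i < y e" "y e < y j"
  shows "\<not> covers y (conj_by i j y)"
proof -
  have ne: "y i \<noteq> e" "y i \<noteq> j" "y e \<noteq> j" "y e \<noteq> i" "y j \<noteq> i" "y j \<noteq> e"
    using assms by (metis FZ_involution less_asym less_trans)+
  define u where "u = conj_by i e y"
  have uF: "u \<in> FZ" using y by (simp add: u_def conj_by_FZ)
  have d: "i \<noteq> e" "i \<noteq> j" "j \<notin> {i, e, y i, y e}" using assms(2,3) ne by auto
  have u: "u i = y e" "u e = y i" "u j = y j"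
    unfolding u_def by (rule conj_by_apply[OF y d(1) ne(1)], rule conj_by_apply[OF y d(1) ne(1)],
        rule conj_by_apply(5)[OF y d(1) ne(1) d(3)])
  define v where "v = conj_by i j u"
  have vF: "v \<in> FZ" using uF by (simp add: v_def conj_by_FZ)
  have d': "u i \<noteq> j" "e \<notin> {i, j, u i, u j}" using u ne d(1) assms(3) FZ_neq[OF y, of e] by auto
  have v: "v i = y j" "v j = y e" "v e = y i"
    unfolding v_def using conj_by_apply(1,2)[OF uF d(2) d'(1)] conj_by_apply(5)[OF uF d(2) d'] u
    by simp_all
  have z: "conj_by i j y = conj_by e j v"
    unfolding u_def v_def using conj_by_braid(1)[of i e j y] assms by simp
  have "bruhat_step y u" unfolding u_def using assms by (intro bruhat_step_conj)
  moreover have "bruhat_step u v" unfolding v_def using assms u by (intro bruhat_step_conj uF) auto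
  moreover have "bruhat_step v (conj_by i j y)"
    unfolding z using assms v by (intro bruhat_step_conj vF) auto
  ultimately show ?thesis using not_covers[OF y] by (meson tranclp.simps)
qed

text \<open>Here two cycles that lie side by side become nested, which raises the length by at least 2. The
  intermediate involution has the two cycles crossing.\<close>

lemma not_covers_nested:
  assumes y: "y \<in> FZ" and "y i < i" "i < y j" "y j < j"
  shows "\<not> covers y (conj_by i j y)"
proof -
  let ?c = "y j"
  define u where "u = conj_by i ?c y"
  have uF: "u \<in> FZ" using y by (simp add: u_def conj_by_FZ)
  have ne: "y i \<noteq> ?c" using assms by simp
  have u: "u ?c = y i" "u j = i"
    unfolding u_def using conj_by_apply(2,4)[OF y _ ne] assms y by simp_all
  have "conj_by ?c j y = y" using conj_by_partner[OF y, of "y j"] y by simp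
  then have z: "conj_by i j y = conj_by ?c j u"
    unfolding u_def using conj_by_braid(2)[of i ?c j y] assms by simp
  have "bruhat_step y u" unfolding u_def using assms by (intro bruhat_step_conj) auto
  moreover have "bruhat_step u (conj_by i j y)"
    unfolding z using assms u by (intro bruhat_step_conj uF) auto
  ultimately show ?thesis using not_covers[OF y] by (meson tranclp.simps)
qed

text \<open>Counting proper inversions as unordered pairs, through a symmetric indicator, allows rows and
  columns of the double sum to be treated alike.\<close>

definition proper_ind :: "(int \<Rightarrow> int) \<Rightarrow> int \<Rightarrow> int \<Rightarrow> nat" where
  "proper_ind z a b = (if (a, b) \<in> proper_inv z \<or> (b, a) \<in> proper_inv z then 1 else 0)"

lemma proper_ind_commute: "proper_ind z a b = proper_ind z b a"
  by (auto simp: proper_ind_def)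

lemma proper_inv_sum:
  assumes "finite K" "proper_inv z \<subseteq> K \<times> K"
  shows "2 * card (proper_inv z) = (\<Sum>a\<in>K. \<Sum>b\<in>K. proper_ind z a b)"
proof -
  have fin: "finite (proper_inv z)" using assms finite_subset by blast
  let ?S = "proper_inv z \<union> (proper_inv z)\<inverse>"
  have "(\<Sum>a\<in>K. \<Sum>b\<in>K. proper_ind z a b) = (\<Sum>e\<in>K \<times> K. if e \<in> ?S then 1 else 0)"
    by (auto simp: sum.cartesian_product proper_ind_def intro!: sum.cong)
  also have "\<dots> = card (K \<times> K \<inter> ?S)" 
    by (simp only: card_eq_sum sum.inter_restrict[OF finite_cartesian_product[OF assms(1) assms(1)]])
  also have "K \<times> K \<inter> ?S = ?S" using assms(2) by auto
  also have "card ?S = card (proper_inv z) + card ((proper_inv z)\<inverse>)"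
    by (rule card_Un_disjoint) (use fin in \<open>auto simp: proper_inv_def\<close>)
  finally show ?thesis by (simp add: card_inverse)
qed

text \<open>Replacing the points \<open>(i, p)\<close>, \<open>(j, c)\<close> of a permutation graph by \<open>(i, c)\<close>,
  \<open>(j, p)\<close> leaves the number of inversions with a further point \<open>(a, u)\<close> unchanged, unless
  that point lies in the rectangle that they span.\<close>

lemma rectangle_exchange:
  fixes a u :: int
  assumes "i < j" "p < c" "\<not> (i < a \<and> a < j \<and> p < u \<and> u < c)" "a \<notin> {i, j}" "u \<notin> {p, c}"
  shows "(if a < i \<and> p < u \<or> i < a \<and> u < p then 1::nat else 0) + (if a < j \<and> c < u \<or> j < a \<and> u < c then 1 else 0)
    = (if a < i \<and> c < u \<or> i < a \<and> u < c then 1 else 0) + (if a < j \<and> p < u \<or> j < a \<and> u < p then 1 else 0)"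
proof -
  have "a < i \<or> i < a \<and> a < j \<or> j < a" "u < p \<or> p < u \<and> u < c \<or> c < u" using assms by auto
  then show ?thesis using assms(1-3) by (elim disjE conjE) auto
qed

text \<open>Only the rows and columns of the four points \<open>i\<close>, \<open>j\<close>, \<open>y i\<close>, \<open>y j\<close>
  change. The rectangle exchange, applied once to \<open>(i, j)\<close> and once to its mirror image, shows
  that a further point meets as many inversions as before. The four points themselves gain two
  proper inversions, which the double sum counts as four, because their cycles change from side
  by side to crossing or from crossing to nested.\<close>

lemma fpf_len_Suc:
  assumes y: "y \<in> FZ" and ij: "i < j" "y i < i" "y i < y j" "y j < i \<or> j < y j"
    and nob: "\<And>e. i < e \<Longrightarrow> e < j \<Longrightarrow> y i < y e \<Longrightarrow> y e < y j \<Longrightarrow> False"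
  shows "fpf_len (conj_by i j y) = Suc (fpf_len y)"
proof -
  define z where "z = conj_by i j y"
  define p where "p = y i"
  define c where "c = y j"
  have zF: "z \<in> FZ" using y by (simp add: z_def conj_by_FZ)
  have yv: "y i = p" "y j = c" "y p = i" "y c = j" using y by (auto simp: p_def c_def)
  have ord: "i < j" "p < i" "p < c" "c < i \<or> j < c" using ij by (auto simp: p_def c_def)
  have dist: "i \<noteq> j" "i \<noteq> p" "i \<noteq> c" "j \<noteq> p" "j \<noteq> c" "p \<noteq> c" using ord by auto
  have zv: "z i = c" "z j = p" "z p = j" "z c = i" "\<And>k. k \<notin> {i, j, p, c} \<Longrightarrow> z k = y k"
  proof -
    have ne: "y i \<noteq> j" using dist yv by simp
    note * = conj_by_apply[OF y dist(1) ne, unfolded yv, folded z_def]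
    show "z i = c" "z j = p" "z p = j" "z c = i" "\<And>k. k \<notin> {i, j, p, c} \<Longrightarrow> z k = y k"
      by (fact *)+
  qed
  define P where "P = {i, j, p, c}"
  define K where "K = P \<union> fst ` (proper_inv y \<union> proper_inv z) \<union> snd ` (proper_inv y \<union> proper_inv z)"
  have K: "finite K" "P \<subseteq> K" "proper_inv y \<subseteq> K \<times> K" "proper_inv z \<subseteq> K \<times> K"
    using finite_proper_inv[OF y] finite_proper_inv[OF zF] by (force simp: K_def P_def)+
  have sumP: "sum f P = f i + f j + f p + f c" for f :: "int \<Rightarrow> nat"
    using dist by (simp add: P_def)
  have outer: "y a \<notin> P" "z a = y a" if "a \<notin> P" for a
  proof -
    have "y a \<noteq> i" "y a \<noteq> j" "y a \<noteq> p" "y a \<noteq> c" using that y yv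
y
      by (auto simp: P_def)
    then show "y a \<notin> P" by (simp add: P_def)
    show "z a = y a" using that zv(5) by (simp add: P_def)
  qed
  have oo: "proper_ind z a b = proper_ind y a b" if "a \<notin> P" "b \<notin> P" for a b
    using outer that by (simp add: proper_ind_def proper_inv_def)
  have oi: "(\<Sum>b\<in>P. proper_ind z a b) = (\<Sum>b\<in>P. proper_ind y a b)" if "a \<notin> P" for a
  proof -
    let ?u = "y a"
    have a: "a \<notin> {i, j}" "?u \<notin> {p, c}" "a \<notin> {p, c}" "?u \<notin> {i, j}"
      using that outer(1)[OF that] by (auto simp: P_def)
    have n1: "\<not> (i < a \<and> a < j \<and> p < ?u \<and> ?u < c)" using nob[of a] by (auto simp: yv)
    have n2: "\<not> (p < a \<and> a < c \<and> i < ?u \<and> ?u < j)" using nob[of "y a"] y by (auto simp: yv)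
    have x: "proper_ind w a b = (if a < b \<and> w b < ?u \<or> b < a \<and> ?u < w b then 1 else 0)"
      if "b \<in> P" "w a = ?u" "w b \<noteq> a" for w b
      using that outer(1)[OF \<open>a \<notin> P\<close>] by (auto simp: proper_ind_def proper_inv_def)
    show ?thesis unfolding sumP
      using rectangle_exchange[OF ord(1,3) n1 a(1,2)] rectangle_exchange[OF ord(3,1) n2 a(3,4)]
        x[of i y] x[of j y] x[of p y] x[of c y] x[of i z] x[of j z] x[of p z] x[of c z]
        outer(2)[OF that] a
      by (simp add: P_def yv zv(1-4))
  qed
  have ii: "(\<Sum>a\<in>P. \<Sum>b\<in>P. proper_ind z a b) = (\<Sum>a\<in>P. \<Sum>b\<in>P. proper_ind y a b) + 4"
    using ord(4)
  proof
    assume "c < i"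
    then show ?thesis unfolding sumP proper_ind_def proper_inv_def using ord(1-3) by (simp add: yv zv(1-4))
  next
    assume "j < c"
    then show ?thesis unfolding sumP proper_ind_def proper_inv_def using ord(1-3) by (simp add: yv zv(1-4))
  qed
  have split: "(\<Sum>a\<in>K. \<Sum>b\<in>K. proper_ind w a b) = (\<Sum>a\<in>K-P. \<Sum>b\<in>K-P. proper_ind w a b)
     + 2 * (\<Sum>a\<in>K-P. \<Sum>b\<in>P. proper_ind w a b) + (\<Sum>a\<in>P. \<Sum>b\<in>P. proper_ind w a b)" for w
  proof -
    have "(\<Sum>a\<in>P. \<Sum>b\<in>K-P. proper_ind w a b) = (\<Sum>a\<in>K-P. \<Sum>b\<in>P. proper_ind w a b)"
      by (subst sum.swap) (simp add: proper_ind_commute)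
    moreover have "(\<Sum>b\<in>K. proper_ind w a b) = (\<Sum>b\<in>K-P. proper_ind w a b) + (\<Sum>b\<in>P. proper_ind w a b)" for a
      using K by (simp add: sum.subset_diff)
    ultimately show ?thesis
      using K sum.subset_diff[of P K "\<lambda>a. \<Sum>b\<in>K. proper_ind w a b"] by (simp add: sum.distrib)
  qed
  have "2 * card (proper_inv z) = 2 * card (proper_inv y) + 4"
    unfolding proper_inv_sum[OF K(1) K(3)] proper_inv_sum[OF K(1) K(4)] split using oo oi ii by simp
  then show ?thesis unfolding z_def[symmetric] fpf_len_def by simp
qed

lemma covers_imp_up:
  assumes y: "y \<in> FZ" and ij: "i < j" and cov: "covers y (conj_by i j y)"
  shows "y i < y j"
proof -
  have "y \<in> {w \<in> FZ. bruhat_le y w \<and> bruhat_less w (conj_by i j y)}"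
    using cov by (auto simp: covers_def)
  then have "fpf_len y < fpf_len (conj_by i j y)"
    using bruhat_le_len[OF y] by (auto simp: bruhat_less_def)
  then show "y i < y j" using conj_by_up[OF y] ij by simp
qed

text \<open>If \<open>i\<close> is the right end of its cycle, the two situations excluded in \<open>fpf_len_Suc\<close>
  are exactly those in which an intermediate element has been exhibited.\<close>

lemma covers_len_right_end:
  assumes y: "y \<in> FZ" and ij: "i < j" "y i < i" and lt: "y i < y j"
    and cov: "covers y (conj_by i j y)"
  shows "fpf_len (conj_by i j y) = Suc (fpf_len y)"
proof (rule fpf_len_Suc[OF y ij lt])
  have "y j \<noteq> j" using y by (rule FZ_neq)
  moreover have "y j \<noteq> i"
  proof
    assume "y j = i"
    then have "y i = j" using y by auto
    then show False using ij by simp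
  qed
  ultimately show "y j < i \<or> j < y j" using not_covers_nested[OF y ij(2), of j] cov by force
  show False if "i < e" "e < j" "y i < y e" "y e < y j" for e
    using not_covers_between[OF y that] cov by simp
qed

text \<open>If \<open>i\<close> is the left end of its cycle, its partner is the right end, and the same
  conjugation is effected by the partners of \<open>i\<close> and \<open>j\<close>.\<close>

lemma covers_len:
  assumes y: "y \<in> FZ" and ij: "i < j" and cov: "covers y (conj_by i j y)"
  shows "fpf_len (conj_by i j y) = Suc (fpf_len y)"
proof (cases "y i < i")
  case True
  show ?thesis by (rule covers_len_right_end[OF y ij True covers_imp_up[OF y ij cov] cov])
next
  case False
  then have "i < y i" using FZ_neq[OF y, of i] by simp
  then have "fpf_len (conj_by (y i) (y j) y) = Suc (fpf_len y)"
    using covers_len_right_end[OF y covers_imp_up[OF y ij cov]] ij cov y conj_by_mirror[OF y, of i j]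
    by simp
  then show ?thesis using conj_by_mirror[OF y, of i j] by simp
qed

section \<open>Marked words\<close>

lemma labels_del_nth:
  assumes "i < length b" "labels b ! i = (L, R)" "j < length b" "j \<noteq> i"
  shows "labels b ! j = (if j < i then map_prod (transpose L R) (transpose L R) (labels (del i b) ! j)
     else labels (del i b) ! (j - 1))"
proof -
  define C where "C = labels (del i b)"
  have len: "length C = length b - 1" using assms(1) by (simp add: C_def length_del)
  have b: "labels b = map (map_prod (transpose L R) (transpose L R)) (take i C) @ (L, R) # drop i C"
    using labels_del[OF assms(1,2)] by (simp add: C_def)
  have i: "length (take i C) = i" using assms(1) len by simp
  show ?thesis
  proof (cases "j < i")
    case True
    then show ?thesis unfolding C_def[symmetric] b using i by (simp add: nth_append)
  next
    case False
    then obtain k where "j = Suc (i + k)" using assms(4) less_imp_Suc_add[of i j] by auto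
    then show ?thesis unfolding C_def[symmetric] b using i assms(3) len by (simp add: nth_append)
  qed
qed

lemma labels_drop:
  assumes "i < length b"
  shows "set (labels (drop (Suc i) b)) \<subseteq> set (labels (del i b))"
    and "i < j \<Longrightarrow> j < length b \<Longrightarrow> labels b ! j \<in> set (labels (drop (Suc i) b))"
proof -
  show "set (labels (drop (Suc i) b)) \<subseteq> set (labels (del i b))"
    by (simp add: del_def labels_append)
  show "labels b ! j \<in> set (labels (drop (Suc i) b))" if "i < j" "j < length b"
  proof -
    have "labels b ! j = labels (drop (Suc i) b) ! (j - Suc i)"
      using that by (simp add: labels_nth)
    then show ?thesis using that by simp
  qed
qed

lemma marked_iff: "marked y (b, i) \<longleftrightarrow> i < length b \<and> del i b \<in> R_FPF y"
  by (simp add: marked_def)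

lemma marked_twist:
  assumes "marked y (b, i)" "labels b ! i = (L, R)"
  shows "twist (word_prod b) = conj_by L R y" "length b = Suc (fpf_len y)" "L \<noteq> R"
proof -
  have i: "i < length b" "twist (word_prod (del i b)) = y" "length (del i b) = fpf_len y"
    using assms(1) by (auto simp: marked_iff R_FPF_iff)
  show "twist (word_prod b) = conj_by L R y"
    unfolding word_prod_del(2)[OF i(1) assms(2)] twist_comp_transpose[OF word_prod_SZ] i(2)
    by (simp add: conj_by_def)
  show "length b = Suc (fpf_len y)" using i length_del[OF i(1)] by simp
  show "L \<noteq> R" using labels_neq[of L R b] assms(2) i(1) by (metis length_labels nth_mem)
qed

lemma is_reduced_iff: "is_reduced (b, i) \<longleftrightarrow> length b = fpf_len (twist (word_prod b))"
  using twist_FZ[OF word_prod_SZ[of b]] by (auto simp: is_reduced_def R_FPF_iff)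

text \<open>Conjugating by \<open>(L, R)\<close> fixes \<open>y\<close> only when \<open>L\<close> and \<open>R\<close> form a cycle.\<close>

lemma semi_reduced_iff:
  assumes y: "y \<in> FZ" and m: "marked y (b, i)" "labels b ! i = (L, R)"
  shows "is_semi_reduced (b, i) \<longleftrightarrow> y L = R"
proof -
  have *: "is_semi_reduced (b, i) \<longleftrightarrow> conj_by L R y = y"
    using m(1) marked_twist(1)[OF m] by (simp add: is_semi_reduced_def marked_iff R_FPF_iff)
  show ?thesis
  proof
    assume "is_semi_reduced (b, i)"
    then have "conj_by L R y L = y L" using * by simp
    then show "y L = R" using conj_by_apply(1)[OF y marked_twist(3)[OF m]] marked_twist(3)[OF m] y
      by (metis FZ_eq_iff)
  next
    assume "y L = R"
    then show "is_semi_reduced (b, i)" using * conj_by_partner[OF y, of L] by simp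
  qed
qed

text \<open>On the right of the mark, \<open>L\<close> stands at the position before \<open>R\<close>. So the reduced word on
  the right of the mark crosses the two strands exactly when their names are in the wrong order.\<close>

lemma suffix_order:
  assumes m: "marked y (b, i)" "labels b ! i = (L, R)"
  shows "R < L \<Longrightarrow> (R, L) \<in> Inv (word_prod (del i b))"
    and "(L, R) \<notin> set (labels (drop (Suc i) b))"
proof -
  define S where "S = word_prod (drop (Suc i) b)"
  have i: "i < length b" and c: "del i b \<in> R_FPF y" using m(1) by (auto simp: marked_iff)
  have "L = inv S (b ! i)" "R = inv S (b ! i + 1)" using labels_nth[OF i] m(2) by (auto simp: S_def)
  then have S: "S L = b ! i" "S R = b ! i + 1" by (simp_all add: S_def bij_is_surj surj_f_inv_f)
  note red = R_FPF_reduced[OF c]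
  have suf: "set (labels (drop (Suc i) b)) = Inv S"
    unfolding S_def
  proof (rule reduced_labels(1), rule reduced_suffix[of "take i b"])
    show "length (take i b @ drop (Suc i) b) = ell (word_prod (take i b @ drop (Suc i) b))"
      using red(1) by (simp add: del_def)
  qed
  show "(L, R) \<notin> set (labels (drop (Suc i) b))" unfolding suf using S by (simp add: Inv_def)
  show "(R, L) \<in> Inv (word_prod (del i b))" if "R < L"
  proof -
    have "(R, L) \<in> Inv S" using S that by (simp add: Inv_def)
    then show ?thesis using suf labels_drop(1)[OF i] red(3) by blast
  qed
qed

text \<open>A marked word is one letter longer than \<open>y\<close>, so it is reduced precisely when its
  involution is longer than \<open>y\<close>. The order of \<open>L\<close> and \<open>R\<close> and that of their partners must
  then agree. They cannot both be reversed, since strands with \<open>R < L\<close> cross on the right of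
  the mark, and all crossings of a word of \<open>y\<close> are proper inversions of \<open>y\<close>.\<close>

lemma marked_reduced_iff:
  assumes y: "y \<in> FZ" and m: "marked y (b, i)" "labels b ! i = (L, R)"
  shows "is_reduced (b, i) \<longleftrightarrow> L < R \<and> y L < y R"
proof
  note tw = marked_twist[OF m]
  have c: "del i b \<in> R_FPF y" using m(1) by (simp add: marked_iff)
  show "L < R \<and> y L < y R" if "is_reduced (b, i)"
  proof -
    have len: "fpf_len y < fpf_len (conj_by L R y)" using that tw by (simp add: is_reduced_iff)
    have "\<not> R < L"
    proof
      assume "R < L"
      then have "y R < y L" using conj_by_up[OF y, of R L] len by (simp add: conj_by_commute[of R L])
      moreover have "(R, L) \<in> proper_inv y" using suffix_order(1)[OF m \<open>R < L\<close>] R_FPF_reduced(2)[OF c] by blast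
      ultimately show False by (simp add: proper_inv_def)
    qed
    then have "L < R" using tw(3) by simp
    then show ?thesis using conj_by_up[OF y _ len] by simp
  qed
  show "is_reduced (b, i)" if "L < R \<and> y L < y R"
    using fpf_len_conj_less[OF y, of L R] that tw fpf_len_le_length[of b] by (simp add: is_reduced_iff)
qed

lemma not_reduced_proper_inv:
  assumes y: "y \<in> FZ" and m: "marked y (b, i)" "labels b ! i = (L, R)"
    and "\<not> is_reduced (b, i)" "y L \<noteq> R"
  shows "(L, R) \<in> proper_inv y \<or> (R, L) \<in> proper_inv y"
proof (cases "R < L")
  case True
  have c: "del i b \<in> R_FPF y" using m(1) by (simp add: marked_iff)
  show ?thesis using suffix_order(1)[OF m True] R_FPF_reduced(2)[OF c] by blast
next
  case False
  then have "L < R" using marked_twist(3)[OF m] by simp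
  then have "\<not> y L < y R" using marked_reduced_iff[OF y m] assms(4) by simp
  moreover have "y L \<noteq> y R" using y \<open>L < R\<close> by simp
  ultimately show ?thesis using \<open>L < R\<close> assms(5) by (simp add: proper_inv_def)
qed

text \<open>For \<open>a\<close> and \<open>b\<close> in different cycles of \<open>y\<close>, these are the ordered pairs of distinct
  points by which \<open>y\<close> has the same conjugate as by \<open>(a, b)\<close>.\<close>

definition linked :: "(int \<Rightarrow> int) \<Rightarrow> int \<Rightarrow> int \<Rightarrow> (int \<times> int) set" where
  "linked y a b = {(a, b), (b, a), (y a, y b), (y b, y a)}"

lemma conj_by_eq_linked:
  assumes y: "y \<in> FZ" and "a \<noteq> b" "y a \<noteq> b" "c \<noteq> d" and eq: "conj_by c d y = conj_by a b y"
  shows "(c, d) \<in> linked y a b"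
proof -
  note ab = conj_by_apply[OF y assms(2,3)]
  have "y c \<noteq> d"
  proof
    assume "y c = d"
    then have "conj_by a b y a = y a" using conj_by_partner[OF y, of c] eq by simp
    then show False using ab(1) assms(2) y by simp
  qed
  note cd = conj_by_apply(1)[OF y assms(4) this]
  have "conj_by a b y c = y d" "y d \<noteq> y c" using cd eq assms(4) y by simp_all
  then have "c \<in> {a, b, y a, y b}" using ab(5) by metis
  then consider "c = a" | "c = b" | "c = y a" | "c = y b" by blast
  then show ?thesis
  proof cases
    case 1
    then have "y d = y b" using ab cd eq by simp
    then show ?thesis using 1 y by (simp add: linked_def)
  next
    case 2
    then have "y d = y a" using ab cd eq by simp
    then show ?thesis using 2 y by (simp add: linked_def)
  next
    case 3
    then have "y d = b" using ab cd eq by simp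
    then show ?thesis using 3 y by (auto simp: linked_def)
  next
    case 4
    then have "y d = a" using ab cd eq by simp
    then show ?thesis using 4 y by (auto simp: linked_def)
  qed
qed

lemma linked_conj_by:
  assumes y: "y \<in> FZ" and "a \<noteq> b" "y a \<noteq> b" and "(c, d) \<in> linked y a b"
  shows "conj_by c d (conj_by a b y) = y"
proof -
  let ?z = "conj_by a b y"
  have zF: "?z \<in> FZ" using y by (rule conj_by_FZ)
  have z: "?z a = y b" "?z b = y a" by (rule conj_by_apply[OF y assms(2,3)])+
  have 1: "conj_by a b ?z = y" by simp
  have 2: "conj_by b a ?z = y" using 1 conj_by_commute[of b a ?z] by simp
  have 3: "conj_by (y b) (y a) ?z = y" using conj_by_mirror[OF zF, of a b] z 1 by simp
  have 4: "conj_by (y a) (y b) ?z = y" using conj_by_mirror[OF zF, of b a] z 2 by simp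
  show ?thesis using assms(4) 1 2 3 4 unfolding linked_def by (elim insertE emptyE) (simp_all only: prod.inject)
qed

text \<open>So it does not matter for membership whether labels are taken in the full word or in the word
  with the mark deleted, which differ by \<open>transpose a b\<close>.\<close>

lemma linked_transpose:
  assumes y: "y \<in> FZ" and "y a \<noteq> b" and "e \<in> linked y a b"
  shows "map_prod (transpose a b) (transpose a b) e \<in> linked y a b"
proof -
  have "y b \<noteq> a" using assms y by auto
  then show ?thesis using assms FZ_neq[OF y, of a] FZ_neq[OF y, of b]
    by (auto simp: linked_def)
qed

lemma linked_transpose_iff:
  assumes y: "y \<in> FZ" and "y a \<noteq> b"
  shows "map_prod (transpose a b) (transpose a b) e \<in> linked y a b \<longleftrightarrow> e \<in> linked y a b"
proof -
  have "map_prod (transpose a b) (transpose a b) (map_prod (transpose a b) (transpose a b) e) = e"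
    by (cases e) simp
  then show ?thesis using linked_transpose[OF assms] by metis
qed

text \<open>Both marks of the same word describe its involution as a conjugate of \<open>y\<close>.\<close>

lemma other_mark_linked:
  assumes y: "y \<in> FZ" and m: "marked y (b, i)" "labels b ! i = (L, R)" "y L \<noteq> R"
    and m': "marked y (b, j)"
  shows "labels b ! j \<in> linked y L R"
proof -
  obtain L' R' where l: "labels b ! j = (L', R')" by (cases "labels b ! j")
  show ?thesis unfolding l
    using conj_by_eq_linked[OF y marked_twist(3)[OF m(1,2)] m(3) marked_twist(3)[OF m' l]]
      marked_twist(1)[OF m(1,2)] marked_twist(1)[OF m' l] by simp
qed

lemma other_mark_deleted:
  assumes y: "y \<in> FZ" and m: "marked y (b, i)" "labels b ! i = (L, R)" "y L \<noteq> R"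
    and j: "j < length b" "j \<noteq> i"
  defines "k \<equiv> (if j < i then j else j - 1)"
  shows "k < length (del i b)"
    and "labels (del i b) ! k \<in> linked y L R \<longleftrightarrow> labels b ! j \<in> linked y L R"
    and "labels (del i b) ! k \<in> Inv (word_prod (del i b))"
    and "labels (del i b) ! k \<in> proper_inv y"
proof -
  have i: "i < length b" and c: "del i b \<in> R_FPF y" using m(1) by (auto simp: marked_iff)
  show k: "k < length (del i b)" using i j by (auto simp: k_def length_del)
  show "labels (del i b) ! k \<in> linked y L R \<longleftrightarrow> labels b ! j \<in> linked y L R"
    using labels_del_nth[OF i m(2) j] linked_transpose_iff[OF y m(3)] by (simp add: k_def)
  show "labels (del i b) ! k \<in> Inv (word_prod (del i b))"
    using R_FPF_reduced(3)[OF c] k by (metis length_labels nth_mem)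
  then show "labels (del i b) ! k \<in> proper_inv y" using R_FPF_reduced(2)[OF c] by blast
qed

text \<open>A second mark would be a linked letter whose label is a proper inversion of \<open>y\<close>; but in
  the reduced case \<open>y\<close> preserves the order of every linked pair.\<close>

lemma reduced_mark_unique:
  assumes y: "y \<in> FZ" and m: "marked y (b, i)" "is_reduced (b, i)" and m': "marked y (b, j)"
  shows "j = i"
proof (rule ccontr)
  assume "j \<noteq> i"
  obtain L R where l: "labels b ! i = (L, R)" by (cases "labels b ! i")
  have LR: "L < R" "y L < y R" using marked_reduced_iff[OF y m(1) l] m(2) by auto
  have "y L \<noteq> R"
  proof
    assume "y L = R"
    then have "y R = L" using y by auto
    then show False using LR \<open>y L = R\<close> by simp
  qed
  note * = other_mark_deleted[OF y m(1) l this _ \<open>j \<noteq> i\<close>]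
  have "j < length b" using m' by (simp add: marked_iff)
  define e where "e = labels (del i b) ! (if j < i then j else j - 1)"
  have "e \<in> linked y L R" "e \<in> proper_inv y"
    using *[OF \<open>j < length b\<close>] other_mark_linked[OF y m(1) l \<open>y L \<noteq> R\<close> m'] by (simp_all add: e_def)
  then show False using LR y by (auto simp: linked_def proper_inv_def)
qed

text \<open>In the remaining case one ordering of \<open>L\<close>, \<open>R\<close> is a proper inversion of \<open>y\<close>. A
  reduced word of \<open>y\<close> crosses exactly one of it and its mirror image, at exactly one letter,
  and the other marks are the letters with such labels.\<close>

lemma other_mark_unique:
  assumes y: "y \<in> FZ" and m: "marked y (b, i)" "\<not> is_reduced (b, i)" "\<not> is_semi_reduced (b, i)"
  shows "\<exists>!j. j \<noteq> i \<and> marked y (b, j)"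
proof -
  obtain L R where l: "labels b ! i = (L, R)" by (cases "labels b ! i")
  have ne: "y L \<noteq> R" using semi_reduced_iff[OF y m(1) l] m(3) by simp
  have i: "i < length b" and c: "del i b \<in> R_FPF y" using m(1) by (auto simp: marked_iff)
  define C where "C = labels (del i b)"
  define v where "v = word_prod (del i b)"
  have v: "v \<in> SZ" "y = twist v" using c word_prod_SZ by (auto simp: v_def R_FPF_iff)
  have C: "set C = Inv v" "distinct C" "length C = length b - 1" 
    using R_FPF_reduced(3,4)[OF c] length_del[OF i] by (simp_all add: C_def v_def)
  obtain e where e: "e \<in> proper_inv y" "linked y L R \<inter> proper_inv y = {e, mirror y e}"
  proof -
    obtain l r where lr: "(l, r) \<in> proper_inv y" "(l, r) = (L, R) \<or> (l, r) = (R, L)"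
      using not_reduced_proper_inv[OF y m(1) l m(2) ne] by auto
    have "linked y L R = {(l, r), (r, l), (y l, y r), (y r, y l)}"
      using lr(2) by (auto simp: linked_def)
    moreover have "(r, l) \<notin> proper_inv y" "(y l, y r) \<notin> proper_inv y" "(y r, y l) \<in> proper_inv y"
      using lr(1) y mirror_proper_inv[OF y, of "(l, r)"] by (auto simp: proper_inv_def)
    ultimately have "linked y L R \<inter> proper_inv y = {(l, r), mirror y (l, r)}" using lr(1) by auto
    then show ?thesis using that lr(1) by blast
  qed
  have half: "mirror y e \<in> Inv v \<longleftrightarrow> e \<notin> Inv v" using proper_inv_half[OF v e(1)] .
  \<comment> \<open>The one of the two candidates that is crossed by the word of \<open>y\<close>.\<close>
  define f where "f = (if e \<in> Inv v then e else mirror y e)"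
  have f: "f \<in> Inv v" "f \<in> linked y L R" using half e(2) by (auto simp: f_def)
  have f_only: "e' = f" if "e' \<in> Inv v" "e' \<in> linked y L R" "e' \<in> proper_inv y" for e'
  proof -
    have "e' = e \<or> e' = mirror y e" using that e(2) by blast
    then show ?thesis using that(1) half by (auto simp: f_def)
  qed
  obtain k where k: "k < length C" "C ! k = f" using f(1) C(1) by (metis in_set_conv_nth)
  \<comment> \<open>The position in \<open>b\<close> of the letter at position \<open>k\<close> of \<open>del i b\<close>.\<close>
  define j where "j = (if k < i then k else Suc k)"
  have j: "j < length b" "j \<noteq> i" "k = (if j < i then j else j - 1)"
    using k(1) C(3) i by (auto simp: j_def)
  have "labels b ! j \<in> linked y L R"
    using other_mark_deleted(2)[OF y m(1) l ne j(1,2)] f(2) k(2) j(3) by (simp add: C_def)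
  moreover obtain L' R' where l': "labels b ! j = (L', R')" by (cases "labels b ! j")
  ultimately have "conj_by L' R' (conj_by L R y) = y"
    using linked_conj_by[OF y marked_twist(3)[OF m(1) l] ne] by simp
  then have "twist (word_prod (del j b)) = y"
    using marked_twist(1)[OF m(1) l]
    unfolding word_prod_del(1)[OF j(1) l'] twist_comp_transpose[OF word_prod_SZ] by (simp add: conj_by_def)
  then have mj: "marked y (b, j)"
    using j(1) marked_twist(2)[OF m(1) l] by (simp add: marked_iff R_FPF_iff length_del)
  have idx: "(if j' < i then j' else j' - 1) = k" if j': "j' \<noteq> i" "marked y (b, j')" for j'
  proof -
    have lt: "j' < length b" using j'(2) by (simp add: marked_iff)
    let ?k = "if j' < i then j' else j' - 1"
    note * = other_mark_deleted[OF y m(1) l ne lt j'(1)]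
    have "C ! ?k = f"
    proof (rule f_only)
      show "C ! ?k \<in> Inv v" using *(3) by (simp add: C_def v_def)
      show "C ! ?k \<in> linked y L R"
        using *(2) other_mark_linked[OF y m(1) l ne j'(2)] by (simp add: C_def)
      show "C ! ?k \<in> proper_inv y" using *(4) by (simp add: C_def)
    qed
    then have eq: "C ! ?k = C ! k" using k(2) by (rule trans[OF _ sym])
    have "?k < length C" using *(1) unfolding C_def length_labels .
    from nth_eq_iff_index_eq[OF C(2) this k(1)] eq show ?thesis by blast
  qed
  show ?thesis
  proof (rule ex1I[of _ j])
    show "j \<noteq> i \<and> marked y (b, j)" using mj j by simp
    show "j' = j" if "j' \<noteq> i \<and> marked y (b, j')" for j'
      using idx[of j'] that j(2,3) by (auto split: if_splits)
  qed
qed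

text \<open>If the mark at \<open>j\<close> had the same orientation as the one at \<open>i\<close>, the strands \<open>L\<close>,
  \<open>R\<close> would cross in the reduced word on the right of \<open>i\<close> and still arrive at \<open>i\<close> in the
  order \<open>L\<close>, \<open>R\<close>. If its label were \<open>(y L, y R)\<close>, a word of \<open>y\<close> would cross both a
  proper inversion of \<open>y\<close> and its mirror image.\<close>

lemma mark_orientation_aux:
  assumes y: "y \<in> FZ" and m: "marked y (b, i)" "labels b ! i = (L, R)" "y L \<noteq> R"
    and j: "i < j" "j < length b"
  shows "labels b ! j \<noteq> (L, R)" "labels b ! j \<noteq> (y L, y R)"
proof -
  have i: "i < length b" and c: "del i b \<in> R_FPF y" using m(1) by (auto simp: marked_iff)
  have mem: "labels b ! j \<in> set (labels (drop (Suc i) b))" using labels_drop(2)[OF i j] .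
  show "labels b ! j \<noteq> (L, R)" using suffix_order(2)[OF m(1,2)] mem by auto
  show "labels b ! j \<noteq> (y L, y R)"
  proof
    assume "labels b ! j = (y L, y R)"
    then have inv: "(y L, y R) \<in> Inv (word_prod (del i b))"
      using mem labels_drop(1)[OF i] R_FPF_reduced(3)[OF c] by auto
    then have "(y L, y R) \<in> proper_inv y" using R_FPF_reduced(2)[OF c] by blast
    then have "R < L" using y by (simp add: proper_inv_def)
    then have RL: "(R, L) \<in> Inv (word_prod (del i b))" by (rule suffix_order(1)[OF m(1,2)])
    then have "(R, L) \<in> proper_inv y" using R_FPF_reduced(2)[OF c] by blast
    moreover have "y = twist (word_prod (del i b))" using c by (simp add: R_FPF_iff)
    ultimately show False using proper_inv_half[OF word_prod_SZ, of y "del i b" "(R, L)"] inv RL by simp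
  qed
qed

text \<open>This is what keeps track of the strands during the algorithm: when the mark moves to another
  letter, the right strand, or its partner, becomes the left strand.\<close>

lemma mark_orientation:
  assumes y: "y \<in> FZ" and m: "marked y (b, i)" "labels b ! i = (L, R)" "y L \<noteq> R"
    and m': "marked y (b, j)" "j \<noteq> i"
  shows "labels b ! j = (R, L) \<or> labels b ! j = (y R, y L)"
proof -
  have "labels b ! j \<noteq> (L, R) \<and> labels b ! j \<noteq> (y L, y R)"
  proof (cases "i < j")
    case True
    moreover have "j < length b" using m'(1) by (simp add: marked_iff)
    ultimately show ?thesis using mark_orientation_aux[OF y m] by blast
  next
    case False
    then have ji: "j < i" "i < length b" using m' m(1) by (auto simp: marked_iff)
    obtain L' R' where l': "labels b ! j = (L', R')" by (cases "labels b ! j")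
    show ?thesis
    proof (cases "y L' = R'")
      case True
      then show ?thesis using l' m(3) y by auto
    next
      case False
      show ?thesis using mark_orientation_aux[OF y m'(1) l' False ji] l' m(2) y by auto
    qed
  qed
  then show ?thesis using other_mark_linked[OF y m m'(1)] by (auto simp: linked_def)
qed

section \<open>Moving the mark\<close>

definition shift :: "int \<Rightarrow> int list \<times> nat \<Rightarrow> int list \<times> nat" where
  "shift d = (\<lambda>(b, i). (b[i := b ! i + d], i))"

text \<open>One step of the algorithm lowers the marked letter and then, if necessary, moves the mark;
  \<open>toggle\<close> is this second half.\<close>

definition toggle :: "(int \<Rightarrow> int) \<Rightarrow> int list \<times> nat \<Rightarrow> int list \<times> nat" where
  "toggle y = (\<lambda>(b, i). (b, if is_reduced (b, i) \<or> is_semi_reduced (b, i) then i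
            else (THE j. j \<noteq> i \<and> marked y (b, j))))"

definition left :: "int list \<times> nat \<Rightarrow> int" where
  "left = (\<lambda>(b, i). fst (labels b ! i))"

definition right :: "int list \<times> nat \<Rightarrow> int" where
  "right = (\<lambda>(b, i). snd (labels b ! i))"

lemma push_eq: "push y m = toggle y (shift (-1) m)"
  by (cases m) (simp add: push_def toggle_def shift_def Let_def)

lemma is_reduced_word: "is_reduced m \<longleftrightarrow> length (fst m) = fpf_len (twist (word_prod (fst m)))"
  by (cases m) (simp add: is_reduced_iff)

lemma fst_toggle [simp]: "fst (toggle y m) = fst m"
  by (cases m) (simp add: toggle_def)

lemma is_reduced_toggle [simp]: "is_reduced (toggle y m) = is_reduced m"
  by (simp add: is_reduced_word)

lemma toggle_reduced: "is_reduced m \<Longrightarrow> toggle y m = m"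
  by (cases m) (simp add: toggle_def)

lemma marked_shift: "marked y m \<Longrightarrow> marked y (shift d m)"
  by (cases m) (simp add: marked_iff shift_def del_def)

lemma shift_shift: "marked y m \<Longrightarrow> shift d (shift e m) = shift (d + e) m"
  by (cases m) (simp add: marked_iff shift_def ac_simps)

lemma shift_0: "shift 0 m = m"
  by (cases m) (simp add: shift_def)

lemma left_right_eq:
  assumes "i < length b"
  shows "left (b, i) = inv (word_prod (drop (Suc i) b)) (b ! i)"
    "right (b, i) = inv (word_prod (drop (Suc i) b)) (b ! i + 1)"
  using labels_nth[OF assms] by (simp_all add: left_def right_def)

text \<open>After the marked letter is lowered from \<open>x\<close> to \<open>x - 1\<close>, it interchanges the strands at
  positions \<open>x - 1\<close> and \<open>x\<close>; the former left strand is now the right one.\<close>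

lemma right_shift: "marked y m \<Longrightarrow> right (shift (-1) m) = left m"
  by (cases m) (simp add: shift_def marked_iff left_right_eq)

lemma left_shift: "marked y m \<Longrightarrow> left (shift 1 m) = right m"
  by (cases m) (simp add: shift_def marked_iff left_right_eq)

lemma sum_list_update_int:
  "i < length b \<Longrightarrow> sum_list (b[i := x]) = sum_list b + x - (b ! i :: int)"
  by (induction b arbitrary: i) (auto split: nat.split)

lemma sum_shift: "marked y m \<Longrightarrow> sum_list (fst (shift d m)) = sum_list (fst m) + d"
  by (cases m) (simp add: shift_def marked_iff sum_list_update_int)

text \<open>Moving the mark is an involution because the other mark is unique and the reduced and
  semi-reduced properties depend on the word only. In the semi-reduced case the mark stays, but
  then its two strands are partners.\<close>

lemma toggle_marked:
  assumes y: "y \<in> FZ" and m: "marked y m"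
  shows "marked y (toggle y m)" "toggle y (toggle y m) = m"
    "\<not> is_reduced m \<Longrightarrow> right (toggle y m) \<in> {left m, y (left m)}"
    "\<not> is_reduced m \<Longrightarrow> left (toggle y m) \<in> {right m, y (right m)}"
proof -
  obtain b i where bi: "m = (b, i)" by (cases m)
  have mi: "marked y (b, i)" using m bi by simp
  obtain L R where l: "labels b ! i = (L, R)" by (cases "labels b ! i")
  have LR: "left m = L" "right m = R" by (simp_all add: bi l left_def right_def)
  have "marked y (toggle y m) \<and> toggle y (toggle y m) = m \<and>
    (\<not> is_reduced m \<longrightarrow> right (toggle y m) \<in> {left m, y (left m)} \<and>
       left (toggle y m) \<in> {right m, y (right m)})"
  proof (cases "is_reduced m \<or> is_semi_reduced m")
    case True
    then have t: "toggle y m = m" by (simp add: toggle_def bi)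
    have "y L = R" if "\<not> is_reduced m" using True that semi_reduced_iff[OF y mi l] bi by simp
    then show ?thesis using m y by (auto simp: t LR)
  next
    case False
    then have nr: "\<not> is_reduced (b, i)" and ns: "\<not> is_semi_reduced (b, i)" by (simp_all add: bi)
    have ne: "y L \<noteq> R" using semi_reduced_iff[OF y mi l] ns by simp
    define j where "j = (THE j. j \<noteq> i \<and> marked y (b, j))"
    have j: "j \<noteq> i" "marked y (b, j)"
      using theI'[OF other_mark_unique[OF y mi nr ns]] by (simp_all add: j_def)
    have t: "toggle y m = (b, j)" using False by (simp add: toggle_def bi j_def)
    have nrj: "\<not> is_reduced (b, j)" using nr by (simp add: is_reduced_iff)
    have nsj: "\<not> is_semi_reduced (b, j)"
      using ns mi j(2) by (simp add: is_semi_reduced_def marked_iff R_FPF_iff)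
    have "(THE k. k \<noteq> j \<and> marked y (b, k)) = i"
      by (rule the1_equality[OF other_mark_unique[OF y j(2) nrj nsj]]) (use j(1) mi in auto)
    then have "toggle y (b, j) = m" using nrj nsj by (simp add: toggle_def bi)
    moreover have "right (b, j) \<in> {L, y L} \<and> left (b, j) \<in> {R, y R}"
      using mark_orientation[OF y mi l ne j(2,1)] by (auto simp: left_def right_def)
    ultimately show ?thesis using t j(2) LR by simp
  qed
  then show "marked y (toggle y m)" "toggle y (toggle y m) = m"
    "\<not> is_reduced m \<Longrightarrow> right (toggle y m) \<in> {left m, y (left m)}"
    "\<not> is_reduced m \<Longrightarrow> left (toggle y m) \<in> {right m, y (right m)}" by blast+
qed

section \<open>Marks cannot travel far without becoming reduced\<close>

text \<open>If \<open>x\<close> is used in a word, its rightmost use moves strands across the gap between \<open>x\<close> and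
  \<open>x + 1\<close> for the first time; the letters on its right keep every strand on its side of
  the gap.\<close>

lemma letter_label:
  "x \<in> set a \<Longrightarrow> \<exists>(l, r)\<in>set (labels a). l \<le> x \<and> x < r \<or> r \<le> x \<and> x < l"
proof (induction a)
  case (Cons x' a)
  show ?case
  proof (cases "x \<in> set a")
    case True
    then show ?thesis using Cons.IH by auto
  next
    case False
    then have "x' = x" using Cons.prems by simp
    have keep: "word_prod c k \<le> x \<longleftrightarrow> k \<le> x" if "x \<notin> set c" for c k
      using that
    proof (induction c)
      case (Cons x'' c)
      have "x'' \<noteq> x" using Cons.prems by simp
      then have "simple x'' n \<le> x \<longleftrightarrow> n \<le> x" for n
        by (auto simp: simple_def transpose_def)
      then show ?case using Cons by (simp add: word_prod_simps)
    qed (simp add: word_prod_simps)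
    let ?w = "word_prod a"
    have "?w (inv ?w x) = x" "?w (inv ?w (x + 1)) = x + 1" by (simp_all add: bij_is_surj surj_f_inv_f)
    then have "inv ?w x \<le> x" "\<not> inv ?w (x + 1) \<le> x"
      using keep[OF False, of "inv ?w x"] keep[OF False, of "inv ?w (x + 1)"] by simp_all
    then show ?thesis using \<open>x' = x\<close> by auto
  qed
qed simp

lemma R_FPF_letters:
  assumes "a \<in> R_FPF z" "x \<in> set a" "proper_inv z \<subseteq> {-M..M} \<times> {-M..M}"
  shows "\<bar>x\<bar> \<le> M"
proof -
  obtain l r where lr: "(l, r) \<in> set (labels a)" "l \<le> x \<and> x < r \<or> r \<le> x \<and> x < l"
    using letter_label[OF assms(2)] by auto
  then have "(l, r) \<in> {-M..M} \<times> {-M..M}" using R_FPF_reduced[OF assms(1)] assms(3) by blast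
  then show ?thesis using lr(2) by auto
qed

lemma word_prod_far:
  assumes "\<And>x. x \<in> set a \<Longrightarrow> \<bar>x\<bar> \<le> M" "\<bar>k\<bar> > M + 1"
  shows "word_prod a k = k"
  using assms
proof (induction a)
  case (Cons x a)
  then have "word_prod a k = k" by simp
  moreover have "simple x k = k" using Cons.prems(1)[of x] Cons.prems(2)
    by (auto simp: simple_def transpose_def)
  ultimately show ?case by (simp add: word_prod_simps)
qed (simp add: word_prod_simps)

text \<open>Far away from the proper inversions of \<open>y\<close>, the word with the mark deleted does nothing and
  \<open>y\<close> agrees with \<open>Theta\<close>. An even letter there interchanges the right end of one cycle of
  \<open>Theta\<close> with the left end of the next and so makes them cross.\<close>

lemma far_even_reduced:
  assumes y: "y \<in> FZ" and M: "proper_inv y \<subseteq> {-M..M} \<times> {-M..M}"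
    and m: "marked y (b, i)" and far: "even (b ! i)" "\<bar>b ! i\<bar> > M + 3"
  shows "is_reduced (b, i)"
proof -
  let ?x = "b ! i"
  have i: "i < length b" and c: "del i b \<in> R_FPF y" using m by (auto simp: marked_iff)
  define S where "S = word_prod (drop (Suc i) b)"
  define v where "v = word_prod (del i b)"
  have letters: "\<bar>x\<bar> \<le> M" if "x \<in> set (del i b)" for x using R_FPF_letters[OF c that M] .
  have vfix: "v k = k" if "\<bar>k\<bar> > M + 1" for k
    unfolding v_def using letters that by (rule word_prod_far)
  have Sfix: "S k = k" if "\<bar>k\<bar> > M + 1" for k
    unfolding S_def by (rule word_prod_far[of _ M]) (use letters that in \<open>auto simp: del_def\<close>)
  have "inv S ?x = ?x" "inv S (?x + 1) = ?x + 1"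
    by (intro inv_f_eq; use Sfix[of ?x] Sfix[of "?x + 1"] far in \<open>simp add: S_def bij_is_inj\<close>)+
  then have l: "labels b ! i = (?x, ?x + 1)" using labels_nth[OF i] by (simp add: S_def)
  have v: "v \<in> SZ" "twist v = y" using c word_prod_SZ by (auto simp: v_def R_FPF_iff)
  have inj: "inj v" using v by (simp add: SZ_bij bij_is_inj)
  have "v (y ?x) = v (?x - 1)"
    using twist_eq[OF v(1), of ?x] v(2) vfix[of ?x] vfix[of "?x - 1"] far by (simp add: Theta_parity)
  then have y1: "y ?x = ?x - 1" using inj by (simp add: inj_eq)
  have "v (y (?x + 1)) = v (?x + 2)"
    using twist_eq[OF v(1), of "?x + 1"] v(2) vfix[of "?x + 1"] vfix[of "?x + 2"] far
    by (simp add: Theta_parity)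
  then have y2: "y (?x + 1) = ?x + 2" using inj by (simp add: inj_eq)
  show ?thesis using marked_reduced_iff[OF y m l] y1 y2 by simp
qed

lemma sum_list_bound:
  "(\<And>x. x \<in> set a \<Longrightarrow> \<bar>x\<bar> \<le> M) \<Longrightarrow> \<bar>sum_list a\<bar> \<le> int (length a) * (M :: int)"
proof (induction a)
  case (Cons x a)
  then have "\<bar>x\<bar> \<le> M" "\<bar>sum_list a\<bar> \<le> int (length a) * M" by simp_all
  then show ?case by (simp add: algebra_simps)
qed simp

lemma sum_list_del: "i < length b \<Longrightarrow> sum_list b = sum_list (del i b) + (b ! i :: int)"
  by (subst id_take_nth_drop[of i b]) (simp_all add: del_def)

text \<open>The unmarked letters are bounded in terms of \<open>y\<close>, so a large sum means that the marked letter
  is far away. One of the two consecutive integers \<open>b ! i\<close> and \<open>b ! i - 1\<close> is even. As the sum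
  changes by 1 in every step of the algorithm, this bound forces it to stop, in both directions.\<close>

lemma nonreduced_sum_bound:
  assumes y: "y \<in> FZ"
  shows "\<exists>C. \<forall>m. marked y m \<longrightarrow> \<not> is_reduced m \<longrightarrow> \<not> is_reduced (shift (-1) m)
     \<longrightarrow> \<bar>sum_list (fst m)\<bar> \<le> C"
proof -
  define M where "M = Max (insert 0 ((\<lambda>(i, j). max \<bar>i\<bar> \<bar>j\<bar>) ` proper_inv y))"
  have fin: "finite (insert 0 ((\<lambda>(i, j). max \<bar>i\<bar> \<bar>j\<bar>) ` proper_inv y))" using finite_proper_inv[OF y] by simp
  have M: "proper_inv y \<subseteq> {-M..M} \<times> {-M..M}"
  proof
    fix e assume "e \<in> proper_inv y"
    moreover obtain i j where e: "e = (i, j)" by (cases e)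
    ultimately have "max \<bar>i\<bar> \<bar>j\<bar> \<le> M" unfolding M_def by (intro Max_ge[OF fin]) force
    then show "e \<in> {-M..M} \<times> {-M..M}" using e by auto
  qed
  \<comment> \<open>\<open>fpf_len y\<close> unmarked letters of size at most \<open>M\<close>, plus a marked letter of size at most \<open>M + 4\<close>.\<close>
  show ?thesis
  proof (intro exI[of _ "int (fpf_len y) * M + M + 4"] allI impI, rule ccontr)
    fix m
    assume m: "marked y m" "\<not> is_reduced m" "\<not> is_reduced (shift (-1) m)"
      and big: "\<not> \<bar>sum_list (fst m)\<bar> \<le> int (fpf_len y) * M + M + 4"
    obtain b i where bi: "m = (b, i)" by (cases m)
    have i: "i < length b" and c: "del i b \<in> R_FPF y" using m(1) by (auto simp: marked_iff bi)
    have "\<bar>sum_list (del i b)\<bar> \<le> int (fpf_len y) * M"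
      using sum_list_bound[of "del i b" M] R_FPF_letters[OF c _ M] c by (simp add: R_FPF_iff)
    then have far: "\<bar>b ! i\<bar> > M + 4" using big sum_list_del[OF i] by (simp add: bi)
    have sh: "shift (-1) m = (b[i := b ! i - 1], i)" by (simp add: bi shift_def)
    have "odd (b ! i)" using far_even_reduced[OF y M, of b i] m far by (auto simp: bi)
    then have "even (b ! i - 1)" by simp
    moreover have "marked y (b[i := b ! i - 1], i)" using marked_shift[OF m(1), of "-1"] sh by simp
    ultimately have "is_reduced (b[i := b ! i - 1], i)"
      using far_even_reduced[OF y M, of "b[i := b ! i - 1]" i] i far by simp
    then show False using m(3) sh by simp
  qed
qed

section \<open>First return maps of bijections\<close>

definition first_return :: "('a \<Rightarrow> 'a) \<Rightarrow> ('a \<Rightarrow> bool) \<Rightarrow> 'a \<Rightarrow> 'a" where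
  "first_return f Q x = (f ^^ (LEAST n. 0 < n \<and> Q ((f ^^ n) x))) x"

text \<open>Here \<open>Q\<close> marks the stopping points, and \<open>U\<close> and \<open>V\<close> differ only in stopping points.
  Running backwards from the first return meets the same points in reverse order, and none
  between the two ends is a stopping point.\<close>

lemma first_return_inverse:
  assumes f: "\<And>x. x \<in> U \<Longrightarrow> f x \<in> V" and gf: "\<And>x. x \<in> U \<Longrightarrow> g (f x) = x"
    and UV: "{x \<in> U. \<not> Q x} = {x \<in> V. \<not> Q x}"
    and x: "x \<in> U" "Q x" and ret: "\<exists>n>0. Q ((f ^^ n) x)"
  shows "first_return f Q x \<in> {x \<in> V. Q x}" "first_return g Q (first_return f Q x) = x"
proof -
  define N where "N = (LEAST n. 0 < n \<and> Q ((f ^^ n) x))"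
  have N: "0 < N" "Q ((f ^^ N) x)"
    using LeastI_ex[OF ret] by (simp_all add: N_def)
  have least: "\<not> Q ((f ^^ k) x)" if "0 < k" "k < N" for k
    using not_less_Least[of k "\<lambda>n. 0 < n \<and> Q ((f ^^ n) x)"] that by (simp add: N_def)
  have inU: "(f ^^ k) x \<in> U" if "k < N" for k
    using that
  proof (induction k)
    case (Suc k)
    then have "(f ^^ Suc k) x \<in> V" using f by simp
    moreover have "\<not> Q ((f ^^ Suc k) x)" using least Suc.prems by blast
    ultimately show "(f ^^ Suc k) x \<in> U" using UV by blast
  qed (simp add: x)
  define z where "z = (f ^^ N) x"
  have z_eq: "first_return f Q x = z" by (simp add: first_return_def z_def N_def)
  obtain N' where N': "N = Suc N'" using N(1) by (cases N) auto
  have "z \<in> V" unfolding z_def N' using f inU[of N'] N' by simp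
  then show "first_return f Q x \<in> {x \<in> V. Q x}" using N(2) z_eq by (simp add: z_def)
  have backward: "(g ^^ k) z = (f ^^ (N - k)) x" if "k \<le> N" for k
    using that
  proof (induction k)
    case (Suc k)
    then have "N - k = Suc (N - Suc k)" by simp
    moreover have "(f ^^ (N - Suc k)) x \<in> U" using inU Suc.prems by simp
    ultimately have "g ((f ^^ (N - k)) x) = (f ^^ (N - Suc k)) x" using gf by simp
    then show "(g ^^ Suc k) z = (f ^^ (N - Suc k)) x" using Suc by simp
  qed (simp add: z_def)
  have "(LEAST n. 0 < n \<and> Q ((g ^^ n) z)) = N"
  proof (rule Least_equality)
    show "0 < N \<and> Q ((g ^^ N) z)" using N(1) x(2) backward[of N] by simp
    show "N \<le> k" if "0 < k \<and> Q ((g ^^ k) z)" for k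
    proof (rule ccontr)
      assume "\<not> N \<le> k"
      then show False using that backward[of k] least[of "N - k"] by simp
    qed
  qed
  then show "first_return g Q (first_return f Q x) = x"
    using backward[of N] by (simp add: z_eq first_return_def[of g])
qed

lemma first_return_bij:
  assumes f: "\<And>x. x \<in> U \<Longrightarrow> f x \<in> V" and g: "\<And>x. x \<in> V \<Longrightarrow> g x \<in> U"
    and gf: "\<And>x. x \<in> U \<Longrightarrow> g (f x) = x" and fg: "\<And>x. x \<in> V \<Longrightarrow> f (g x) = x"
    and UV: "{x \<in> U. \<not> Q x} = {x \<in> V. \<not> Q x}"
    and ret_f: "\<And>x. x \<in> U \<Longrightarrow> Q x \<Longrightarrow> \<exists>n>0. Q ((f ^^ n) x)"
    and ret_g: "\<And>x. x \<in> V \<Longrightarrow> Q x \<Longrightarrow> \<exists>n>0. Q ((g ^^ n) x)"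
  shows "bij_betw (first_return f Q) {x \<in> U. Q x} {x \<in> V. Q x}"
proof -
  note F = first_return_inverse[OF f gf UV]
  note G = first_return_inverse[OF g fg UV[symmetric]]
  show ?thesis
  proof (rule bij_betw_byWitness[where f' = "first_return g Q"])
    show "\<forall>x\<in>{x \<in> U. Q x}. first_return g Q (first_return f Q x) = x" using F(2) ret_f by blast
    show "\<forall>x\<in>{x \<in> V. Q x}. first_return f Q (first_return g Q x) = x" using G(2) ret_g by blast
    show "first_return f Q ` {x \<in> U. Q x} \<subseteq> {x \<in> V. Q x}" using F(1) ret_f by blast
    show "first_return g Q ` {x \<in> V. Q x} \<subseteq> {x \<in> U. Q x}" using G(1) ret_g by blast
  qed
qed

section \<open>The Little map\<close>

definition left_marked :: "(int \<Rightarrow> int) \<Rightarrow> int \<Rightarrow> (int list \<times> nat) set" where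
  "left_marked y p = {m. marked y m \<and> left m \<in> {p, y p}}"

text \<open>The image of \<open>left_marked\<close> under \<open>push\<close>: lowering the marked letter puts the chosen
  strand, or its partner, on the right of the mark, and it returns to the left unless the word has
  become reduced.\<close>

definition pushed :: "(int \<Rightarrow> int) \<Rightarrow> int \<Rightarrow> (int list \<times> nat) set" where
  "pushed y p = {m. marked y m \<and> (if is_reduced m then right m else left m) \<in> {p, y p}}"

text \<open>The inverse of \<open>push\<close> on marked words.\<close>

definition pull :: "(int \<Rightarrow> int) \<Rightarrow> int list \<times> nat \<Rightarrow> int list \<times> nat" where
  "pull y m = shift 1 (toggle y m)"

lemma push_pull:
  assumes y: "y \<in> FZ" and m: "marked y m"
  shows "push y (pull y m) = m" "pull y (push y m) = m"
proof -
  have "shift (-1) (shift 1 (toggle y m)) = toggle y m"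
    using shift_shift[OF toggle_marked(1)[OF y m], of "-1" 1] by (simp add: shift_0)
  then show "push y (pull y m) = m" by (simp add: push_eq pull_def toggle_marked(2)[OF y m])
  show "pull y (push y m) = m"
    using toggle_marked(2)[OF y marked_shift[OF m, of "-1"]] shift_shift[OF m, of 1 "-1"]
    by (simp add: push_eq pull_def shift_0)
qed

lemma push_left_marked:
  assumes y: "y \<in> FZ" and m: "m \<in> left_marked y p"
  shows "push y m \<in> pushed y p"
proof -
  let ?d = "shift (-1) m"
  have mm: "marked y m" "left m \<in> {p, y p}" using m by (auto simp: left_marked_def)
  have d: "marked y ?d" "right ?d \<in> {p, y p}" using marked_shift[OF mm(1)] right_shift[OF mm(1)] mm(2) by simp_all
  show ?thesis
  proof (cases "is_reduced ?d")
    case True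
    then show ?thesis using d by (simp add: push_eq pushed_def toggle_reduced)
  next
    case False
    have "left (toggle y ?d) \<in> {p, y p}" using toggle_marked(4)[OF y d(1) False] d(2) y by auto
    then show ?thesis using toggle_marked(1)[OF y d(1)] False by (simp add: push_eq pushed_def)
  qed
qed

lemma pull_pushed:
  assumes y: "y \<in> FZ" and m: "m \<in> pushed y p"
  shows "pull y m \<in> left_marked y p"
proof -
  have mm: "marked y m" using m by (simp add: pushed_def)
  note t = toggle_marked[OF y mm]
  have "right (toggle y m) \<in> {p, y p}"
  proof (cases "is_reduced m")
    case True
    then show ?thesis using m by (simp add: pushed_def toggle_reduced)
  next
    case False
    then have "left m \<in> {p, y p}" using m by (simp add: pushed_def)
    then show ?thesis using t(3)[OF False] y by auto
  qed
  then show ?thesis using marked_shift[OF t(1), of 1] left_shift[OF t(1)]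
    by (simp add: left_marked_def pull_def)
qed

lemma push_returns:
  assumes y: "y \<in> FZ" and m: "marked y m"
  shows "\<exists>n>0. is_reduced ((push y ^^ n) m)"
proof (rule ccontr)
  assume "\<not> ?thesis"
  then have nr: "\<not> is_reduced ((push y ^^ n) m)" if "0 < n" for n using that by blast
  obtain C where C: "\<forall>m. marked y m \<longrightarrow> \<not> is_reduced m \<longrightarrow> \<not> is_reduced (shift (-1) m)
     \<longrightarrow> \<bar>sum_list (fst m)\<bar> \<le> C" using nonreduced_sum_bound[OF y] ..
  have *: "marked y ((push y ^^ n) m) \<and> sum_list (fst ((push y ^^ n) m)) = sum_list (fst m) - int n" for n
  proof (induction n)
    case (Suc n)
    then have m': "marked y ((push y ^^ n) m)"
      "sum_list (fst ((push y ^^ n) m)) = sum_list (fst m) - int n" by simp_all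
    have "(push y ^^ Suc n) m = toggle y (shift (-1) ((push y ^^ n) m))" by (simp add: push_eq)
    then show ?case
      using toggle_marked(1)[OF y marked_shift[OF m'(1)]] sum_shift[OF m'(1)] m'(2) by simp
  qed (simp add: m)
  \<comment> \<open>Enough steps to carry the sum beyond the bound.\<close>
  define n where "n = Suc (nat (C + \<bar>sum_list (fst m)\<bar>))"
  have "\<not> is_reduced (shift (-1) ((push y ^^ n) m))" using nr[of "Suc n"] by (simp add: push_eq)
  moreover have "0 < n" by (simp add: n_def)
  ultimately have "\<bar>sum_list (fst m) - int n\<bar> \<le> C"
    using C[rule_format, OF conjunct1[OF *[of n]] nr] *[of n] by simp
  then show False unfolding n_def by linarith
qed

lemma pull_returns:
  assumes y: "y \<in> FZ" and m: "marked y m"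
  shows "\<exists>n>0. is_reduced ((pull y ^^ n) m)"
proof (rule ccontr)
  assume "\<not> ?thesis"
  then have nr: "\<not> is_reduced ((pull y ^^ n) m)" if "0 < n" for n using that by blast
  obtain C where C: "\<forall>m. marked y m \<longrightarrow> \<not> is_reduced m \<longrightarrow> \<not> is_reduced (shift (-1) m)
     \<longrightarrow> \<bar>sum_list (fst m)\<bar> \<le> C" using nonreduced_sum_bound[OF y] ..
  have *: "marked y ((pull y ^^ n) m) \<and> sum_list (fst ((pull y ^^ n) m)) = sum_list (fst m) + int n" for n
  proof (induction n)
    case (Suc n)
    then show ?case using marked_shift[OF toggle_marked(1)[OF y]] sum_shift[OF toggle_marked(1)[OF y]]
      by (simp add: pull_def)
  qed (simp add: m)
  define n where "n = Suc (nat (C + \<bar>sum_list (fst m)\<bar>))"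
  let ?m = "(pull y ^^ n) m"
  have "shift (-1) (pull y ?m) = toggle y ?m"
    using shift_shift[OF toggle_marked(1)[OF y], of ?m "-1" 1] * by (simp add: pull_def shift_0)
  then have "\<not> is_reduced (shift (-1) ((pull y ^^ Suc n) m))" using nr[of n] by (simp add: n_def)
  then have "\<bar>sum_list (fst m) + int (Suc n)\<bar> \<le> C" using C[rule_format, of "(pull y ^^ Suc n) m"] *[of "Suc n"] nr[of "Suc n"] by simp
  then show False unfolding n_def by linarith
qed

text \<open>The Little map is the first return map of \<open>push\<close> to reduced words. The orbit of a word whose
  mark has \<open>p\<close> or \<open>y p\<close> on the left keeps this property until it becomes reduced again,
  and then the strand is on the right.\<close>

lemma little_bij:
  assumes y: "y \<in> FZ"
  shows "bij_betw (little y) {m. marked y m \<and> is_reduced m \<and> left m \<in> {p, y p}}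
     {m. marked y m \<and> is_reduced m \<and> right m \<in> {p, y p}}"
proof -
  have "bij_betw (first_return (push y) is_reduced)
     {m \<in> left_marked y p. is_reduced m} {m \<in> pushed y p. is_reduced m}"
  proof (rule first_return_bij[where g = "pull y"])
    show "{m \<in> left_marked y p. \<not> is_reduced m} = {m \<in> pushed y p. \<not> is_reduced m}"
      by (auto simp: left_marked_def pushed_def)
  next
    fix m
    assume m: "m \<in> left_marked y p"
    then have mm: "marked y m" by (simp add: left_marked_def)
    show "push y m \<in> pushed y p" by (rule push_left_marked[OF y m])
    show "pull y (push y m) = m" by (rule push_pull(2)[OF y mm])
    show "\<exists>n>0. is_reduced ((push y ^^ n) m)" by (rule push_returns[OF y mm])
  next
    fix m
    assume m: "m \<in> pushed y p"
    then have mm: "marked y m" by (simp add: pushed_def)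
    show "pull y m \<in> left_marked y p" by (rule pull_pushed[OF y m])
    show "push y (pull y m) = m" by (rule push_pull(1)[OF y mm])
    show "\<exists>n>0. is_reduced ((pull y ^^ n) m)" by (rule pull_returns[OF y mm])
  qed
  moreover have "little y = first_return (push y) is_reduced"
    by (simp add: fun_eq_iff little_def first_return_def)
  moreover have "{m \<in> left_marked y p. is_reduced m} = {m. marked y m \<and> is_reduced m \<and> left m \<in> {p, y p}}"
    "{m \<in> pushed y p. is_reduced m} = {m. marked y m \<and> is_reduced m \<and> right m \<in> {p, y p}}"
    by (auto simp: left_marked_def pushed_def)
  ultimately show ?thesis by simp
qed

text \<open>A word of the longer involution crosses \<open>(i, j)\<close> or its mirror image, which is
  \<open>(y i, y j)\<close>; deleting that letter leaves a word of \<open>y\<close>.\<close>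

lemma exists_mark:
  assumes y: "y \<in> FZ" and ij: "i < j" "y i < y j"
    and z: "z = conj_by i j y" "fpf_len z = Suc (fpf_len y)" and a: "a \<in> R_FPF z"
  obtains k where "marked y (a, k)" "is_reduced (a, k)"
    "labels a ! k = (i, j) \<or> labels a ! k = (y i, y j)"
proof -
  have zF: "z \<in> FZ" using y z by (simp add: conj_by_FZ)
  have "y i \<noteq> j" using ij y by (metis FZ_involution less_asym)
  then have zv: "z i = y j" "z j = y i" using conj_by_apply(1,2)[OF y _ \<open>y i \<noteq> j\<close>] ij z by simp_all
  have "y j \<noteq> j" using y by (rule FZ_neq)
  then have ze: "(i, j) \<in> proper_inv z" using ij zv by (simp add: proper_inv_def)
  have tw: "twist (word_prod a) = z" "length a = fpf_len z" using a by (auto simp: R_FPF_iff)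
  have "(i, j) \<in> Inv (word_prod a) \<or> (y i, y j) \<in> Inv (word_prod a)"
    using proper_inv_half[OF word_prod_SZ tw(1)[symmetric] ze] zv by auto
  then obtain l r where lr: "(l, r) \<in> Inv (word_prod a)" "(l, r) = (i, j) \<or> (l, r) = (y i, y j)"
    by blast
  then have "(l, r) \<in> set (labels a)" using R_FPF_reduced(3)[OF a] by simp
  then obtain k where k: "k < length a" "labels a ! k = (l, r)" by (auto simp: in_set_conv_nth)
  have "conj_by l r z = y"
  proof (cases "(l, r) = (i, j)")
    case True
    then show ?thesis using z by simp
  next
    case False
    then have "l = z j" "r = z i" using lr(2) zv by auto
    then have "conj_by l r z = conj_by (z j) (z i) z" by simp
    also have "\<dots> = conj_by i j z" using conj_by_mirror[OF zF, of j i] conj_by_commute[of j i z] by simp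
    finally show ?thesis using z by simp
  qed
  then have "twist (word_prod (del k a)) = y"
    unfolding word_prod_del(1)[OF k] twist_comp_transpose[OF word_prod_SZ] tw by (simp add: conj_by_def)
  then have "marked y (a, k)" using k(1) tw(2) z(2) by (simp add: marked_iff R_FPF_iff length_del)
  moreover have "is_reduced (a, k)" using tw by (simp add: is_reduced_iff)
  ultimately show ?thesis using that k(2) lr(2) by simp
qed

text \<open>Conjugation by \<open>(q, j)\<close> is conjugation by \<open>(p, y j)\<close>, so a word of a cover in \<open>Psi_plus y q\<close> may
  be marked at a letter with left strand \<open>q\<close> or at one with left strand \<open>p\<close>. The algorithm does
  not distinguish the two strands either. The same holds for \<open>Psi_minus y p\<close> with right
  strands.\<close>

lemma Psi_words:
  assumes y: "y \<in> FZ" and pq: "p < q" "y p = q"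
  shows "(\<Union>z\<in>Psi_plus y q. R_FPF z) = {a. \<exists>i. marked y (a, i) \<and> is_reduced (a, i) \<and> left (a, i) \<in> {p, q}}"
    and "(\<Union>z\<in>Psi_minus y p. R_FPF z) = {a. \<exists>i. marked y (a, i) \<and> is_reduced (a, i) \<and> right (a, i) \<in> {p, q}}"
proof -
  have yq: "y q = p" using y pq by auto
  have cov: "covers y z" "z \<in> FZ" "a \<in> R_FPF z" "z = conj_by L R y" "L < R" "y L < y R"
    if "marked y (a, i)" "is_reduced (a, i)" "labels a ! i = (L, R)" "z = twist (word_prod a)" for a i L R z
  proof -
    note tw = marked_twist[OF that(1,3)]
    show LR: "L < R" "y L < y R" using marked_reduced_iff[OF y that(1,3)] that(2) by auto
    show z: "z = conj_by L R y" using tw that(4) by simp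
    show "z \<in> FZ" using z y by (simp add: conj_by_FZ)
    have len: "length a = fpf_len z" using that by (simp add: is_reduced_iff)
    then show "a \<in> R_FPF z" using that(4) by (simp add: R_FPF_iff)
    show "covers y z" unfolding z using covers_if_len[OF y LR] len tw(2) z by simp
  qed
  show "(\<Union>z\<in>Psi_plus y q. R_FPF z) = {a. \<exists>i. marked y (a, i) \<and> is_reduced (a, i) \<and> left (a, i) \<in> {p, q}}"
    (is "?A = ?B")
  proof (intro equalityI subsetI)
    fix a assume "a \<in> ?A"
    then obtain z j where z: "covers y z" "q < j" "z = conj_by q j y" "a \<in> R_FPF z"
      by (auto simp: Psi_plus_def conj_by_def)
    have up: "y q < y j" using covers_imp_up[OF y z(2)] z(1,3) by simp
    have "fpf_len z = Suc (fpf_len y)" using covers_len[OF y z(2)] z(1,3) by simp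
    from exists_mark[OF y z(2) up z(3) this z(4)] obtain k
      where "marked y (a, k)" "is_reduced (a, k)" "labels a ! k = (q, j) \<or> labels a ! k = (y q, y j)" .
    then show "a \<in> ?B" using yq by (auto simp: left_def)
  next
    fix a assume "a \<in> ?B"
    then obtain i where i: "marked y (a, i)" "is_reduced (a, i)" "left (a, i) \<in> {p, q}" by blast
    obtain L R where l: "labels a ! i = (L, R)" by (cases "labels a ! i")
    note c = cov[OF i(1,2) l refl]
    have "\<exists>j>q. conj_by L R y = conj_by q j y"
    proof (cases "L = q")
      case True
      then show ?thesis using c(5) by blast
    next
      case False
      then have "L = p" using i(3) l by (simp add: left_def)
      then show ?thesis using c(6) conj_by_mirror[OF y, of L R] pq by (intro exI[of _ "y R"]) simp
    qed
    then show "a \<in> ?A" using c(1-4) by (auto simp: Psi_plus_def conj_by_def)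
  qed
  show "(\<Union>z\<in>Psi_minus y p. R_FPF z) = {a. \<exists>i. marked y (a, i) \<and> is_reduced (a, i) \<and> right (a, i) \<in> {p, q}}"
    (is "?A = ?B")
  proof (intro equalityI subsetI)
    fix a assume "a \<in> ?A"
    then obtain z i where z: "covers y z" "i < p" "z = conj_by i p y" "a \<in> R_FPF z"
      by (auto simp: Psi_minus_def conj_by_def)
    have up: "y i < y p" using covers_imp_up[OF y z(2)] z(1,3) by simp
    have "fpf_len z = Suc (fpf_len y)" using covers_len[OF y z(2)] z(1,3) by simp
    from exists_mark[OF y z(2) up z(3) this z(4)] obtain k
      where "marked y (a, k)" "is_reduced (a, k)" "labels a ! k = (i, p) \<or> labels a ! k = (y i, y p)" .
    then show "a \<in> ?B" using pq by (auto simp: right_def)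
  next
    fix a assume "a \<in> ?B"
    then obtain i where i: "marked y (a, i)" "is_reduced (a, i)" "right (a, i) \<in> {p, q}" by blast
    obtain L R where l: "labels a ! i = (L, R)" by (cases "labels a ! i")
    note c = cov[OF i(1,2) l refl]
    have "\<exists>k<p. conj_by L R y = conj_by k p y"
    proof (cases "R = p")
      case True
      then show ?thesis using c(5) by blast
    next
      case False
      then have "R = q" using i(3) l by (simp add: right_def)
      then show ?thesis using c(6) conj_by_mirror[OF y, of L R] yq by (intro exI[of _ "y L"]) simp
    qed
    then show "a \<in> ?A" using c(1-4) by (auto simp: Psi_minus_def conj_by_def)
  qed
qed

theorem theorem4p29:
  fixes y :: "int \<Rightarrow> int" and p q :: int
  assumes "y \<in> FZ" and "(p, q) \<in> Cyc y"
  shows "bij_betw (little_y y) (\<Union>z\<in>Psi_plus y q. R_FPF z) (\<Union>z\<in>Psi_minus y p. R_FPF z)"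
proof -
  note y = assms(1)
  have pq: "p < q" "y p = q" using assms(2) FZ_neq[OF y, of p] by (auto simp: Cyc_def)
  let ?A = "{m. marked y m \<and> is_reduced m \<and> left m \<in> {p, y p}}"
  let ?B = "{m. marked y m \<and> is_reduced m \<and> right m \<in> {p, y p}}"
  define mark where "mark a = (a, THE i. marked y (a, i) \<and> is_reduced (a, i))" for a
  have mark: "mark a = (a, i)" if "marked y (a, i)" "is_reduced (a, i)" for a i
  proof -
    have "(THE i. marked y (a, i) \<and> is_reduced (a, i)) = i"
    proof (rule the_equality)
      show "marked y (a, i) \<and> is_reduced (a, i)" using that by simp
      show "j = i" if "marked y (a, j) \<and> is_reduced (a, j)" for j
        by (rule reduced_mark_unique[OF y \<open>marked y (a, i)\<close> \<open>is_reduced (a, i)\<close>]) (simp add: that)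
    qed
    then show ?thesis by (simp add: mark_def)
  qed
  have fst_image: "fst ` {m. P m} = {a. \<exists>i. P (a, i)}" for P :: "int list \<times> nat \<Rightarrow> bool" by force
  have A: "(\<Union>z\<in>Psi_plus y q. R_FPF z) = fst ` ?A"
    by (simp only: Psi_words(1)[OF y pq] fst_image pq(2))
  have B: "(\<Union>z\<in>Psi_minus y p. R_FPF z) = fst ` ?B"
    by (simp only: Psi_words(2)[OF y pq] fst_image pq(2))
  have "bij_betw mark (fst ` ?A) ?A"
    by (rule bij_betw_byWitness[where f' = fst]) (use mark in auto)
  then have "bij_betw (little y \<circ> mark) (fst ` ?A) ?B"
    by (rule bij_betw_trans) (rule little_bij[OF y])
  moreover have "bij_betw fst ?B (fst ` ?B)"
    by (rule bij_betw_byWitness[where f' = mark]) (use mark in auto)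
  ultimately have "bij_betw (fst \<circ> (little y \<circ> mark)) (fst ` ?A) (fst ` ?B)"
    by (rule bij_betw_trans)
  moreover have "fst \<circ> (little y \<circ> mark) = little_y y"
    by (simp add: fun_eq_iff little_y_def mark_def)
  ultimately show ?thesis using A B by simp
qed

end
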